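(* Let $(\Omega,\mathcal{F},(\mathcal{F}_t)_{t\ge 0},\mathbb{P})$ be a filtered probability space satisfying property (NP), let $(X_t)_{t\ge 0}$ be a submartingale of class $(\Sigma)$ on it with decomposition $X_t=N_t+A_t$, and let $\mathcal{Q}$ be the associated $\sigma$-finite measure. Suppose that $A_\infty=\infty$, $\mathbb{P}$-almost surely. Let $(Z_t)_{t\ge0}$ be a nonnegative, càdlàg $\mathbb{P}$-martingale, and let $\mathbb{Q}_Z$ be the unique finite measure on $(\Omega,\mathcal{F})$ such that for all $t\ge0$ its restriction to $\mathcal{F}_t$ has density $Z_t$ with respect to $\mathbb{P}$. Let $Z_\infty$ be the $\mathbb{P}$-almost sure limit of $Z_t$ and $z_\infty$ the $\mathcal{Q}$-almost everywhere limit of $Z_t/X_t$ as $t\to\infty$, and let $\xi_t=Z_t-M_t(z_\infty)-\mathbb{P}[Z_\infty|\mathcal{F}_t]$. Then $$\mathbb{Q}_Z=z_\infty.\mathcal{Q}+Z_\infty.\mathbb{P}+\mathbb{Q}_\xi,$$ where $\mathbb{Q}_\xi$ is the finite (nonnegative) measure whose restriction to $\mathcal{F}_t$ has density $\xi_t$ with respect to $\mathbb{P}$ for all $t\ge0$, and $\mathbb{Q}_\xi$ is singular with respect to $\mathbb{P}$ and singular with respect to $\mathcal{Q}$. Thus $\mathbb{Q}_Z$ is the sum of a measure absolutely continuous with respect to $\mathbb{P}$, a measure absolutely continuous with respect to $\mathcal{Q}$, and a measure singular with respect to both $\mathbb{P}$ and $\mathcal{Q}$; moreover such a decomposition of $\mathbb{Q}_Z$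 is unique.
   Context: Notation: $\mathbb{P}[Y]$ denotes the expectation of $Y$ under $\mathbb{P}$ (and $\mathcal{Q}[Y]$ the integral of $Y$ under $\mathcal{Q}$); $F.\mu$ denotes the measure with density $F$ with respect to $\mu$; for an increasing process $(A_t)$, $A_\infty=\lim_{t\to\infty}A_t$. Class $(\Sigma)$: a nonnegative submartingale $(X_t)_{t\ge0}$ is of class $(\Sigma)$ iff $X_t=N_t+A_t$ where $(N_t)$ and $(A_t)$ are adapted, $(N_t)$ is a càdlàg martingale, $(A_t)$ is a continuous increasing process with $A_0=0$, and the measure $(dA_t)$ is carried by $\{t\ge0: X_t=0\}$. (In particular $X_t$ is integrable for all $t$.) Natural conditions: $(\Omega,\mathcal{F},(\mathcal{F}_t),\mathbb{P})$ satisfies the natural conditions iff $(\mathcal{F}_t)$ is right-continuous and, for all $t\ge0$ and every $\mathbb{P}$-negligible $A\in\mathcal{F}_t$, all subsets of $A$ belong to $\mathcal{F}_0$. The natural enlargement of a filtered probability space is its smallest extension (same $\Omega$, larger $\sigma$-algebras, extended probability) satisfying the natural conditions; it exists and is unique. Property (P): a filtered measurable space $(\Omega,\mathcal{F},(\mathcal{F}_t))$ with $\mathcal{F}=\bigvee_{t\ge0}\mathcal{F}_t$ satisfies (P) iff (i) each $\mathcal{F}_t$ is countably generated; (ii) for each $t$ there are a Polish space $\Omega_t$ and a surjection $\pi_t:\Omega\to\Omega_t$ such that $\mathcal{F}_t$ is the $\sigma$-algebra of inverse images under $\pi_t$ of Borel sets of $\Omega_t$, and for all $B\in\mathcal{F}_t$,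 $\omega\in\Omega$, $\pi_t(\omega)\in\pi_t(B)$ implies $\omega\in B$; (iii) if $(\omega_n)_{n\ge0}$ is a sequence in $\Omega$ with $\bigcap_{n=0}^N A_n(\omega_n)\ne\emptyset$ for all $N\ge0$, where $A_n(\omega_n)$ is the intersection of the sets of $\mathcal{F}_n$ containing $\omega_n$, then $\bigcap_{n=0}^\infty A_n(\omega_n)\neq\emptyset$. Property (NP): a filtered probability space satisfies (NP) iff it is the natural enlargement of a filtered probability space $(\Omega,\mathcal{F}^0,(\mathcal{F}^0_t),\mathbb{P}^0)$ such that $(\Omega,\mathcal{F}^0,(\mathcal{F}^0_t))$ satisfies (P). In this case $\mathcal{F}=\bigvee_{t\ge 0}\mathcal{F}_t$, and (known) any coherent family of probability measures $(\mathbb{Q}_t)_{t\ge0}$, with $\mathbb{Q}_t$ defined on $\mathcal{F}_t$ and absolutely continuous with respect to the restriction of $\mathbb{P}$ to $\mathcal{F}_t$, extends to a unique probability measure on $\mathcal{F}$; this gives existence and uniqueness of $\mathbb{Q}_Z$. The measure $\mathcal{Q}$ (known theorem): if $(X_t)$ is a submartingale of class $(\Sigma)$ on a space satisfying (NP) and $g:=\sup\{t\ge0: X_t=0\}$ (with $\sup\emptyset=0$), there is a unique $\sigma$-finite measure $\mathcal{Q}$ on $(\Omega,\mathcal{F})$ such that $\mathcal{Q}[g=\infty]=0$ and, for all $t\ge0$ and all bounded $\mathcal{F}_t$-measurable $F_t$, $\mathcal{Q}[F_t\mathds{1}_{g\le t}]=\mathbb{P}[F_tX_t]$. The martingale $M_t(F)$: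 for a nonnegative, $\mathcal{Q}$-integrable functional $F$ on $(\Omega,\mathcal{F})$, $(M_t(F))_{t\ge0}$ denotes the càdlàg $\mathbb{P}$-martingale, unique up to indistinguishability, such that $\mathcal{Q}[F\,\Gamma_t]=\mathbb{P}[\Gamma_tM_t(F)]$ for all $t\ge0$ and all bounded $\mathcal{F}_t$-measurable $\Gamma_t$. In this setting the limit $z_\infty$ exists $\mathcal{Q}$-almost everywhere ($X_t>0$ for $t$ large, $\mathcal{Q}$-a.e.) and is $\mathcal{Q}$-integrable, $Z_\infty$ is $\mathbb{P}$-integrable, and $\xi$ is (for suitable càdlàg versions of $M_t(z_\infty)$ and $\mathbb{P}[Z_\infty|\mathcal{F}_t]$) a nonnegative càdlàg $\mathbb{P}$-martingale. *)

theory Defs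
  imports "HOL-Probability.Probability"
begin

section \<open>Filtered spaces\<close>

text \<open>Time is \<^typ>\<open>real\<close>, and only \<open>t \<ge> 0\<close> is ever used.  A filtration is a family of
  measures \<open>F t\<close> of which only the underlying \<open>\<sigma>\<close>-algebras matter.\<close>

definition filtered_space :: "'a measure \<Rightarrow> (real \<Rightarrow> 'a measure) \<Rightarrow> bool" where
  "filtered_space M F \<longleftrightarrow>
     (\<forall>t\<ge>0. subalgebra M (F t)) \<and> (\<forall>s\<ge>0. \<forall>t\<ge>s. subalgebra (F t) (F s))"

definition filtered_prob_space :: "'a measure \<Rightarrow> (real \<Rightarrow> 'a measure) \<Rightarrow> bool" where
  "filtered_prob_space P F \<longleftrightarrow> prob_space P \<and> filtered_space P F"

definition natural_conditions :: "'a measure \<Rightarrow> (real \<Rightarrow> 'a measure) \<Rightarrow> bool" where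
  "natural_conditions P F \<longleftrightarrow>
     filtered_prob_space P F \<and>
     (\<forall>t\<ge>0. sets (F t) = (\<Inter>s\<in>{t<..}. sets (F s))) \<and>
     (\<forall>t\<ge>0. \<forall>A\<in>sets (F t). emeasure P A = 0 \<longrightarrow> (\<forall>B\<subseteq>A. B \<in> sets (F 0)))"

definition filtered_extension ::
  "'a measure \<Rightarrow> (real \<Rightarrow> 'a measure) \<Rightarrow> 'a measure \<Rightarrow> (real \<Rightarrow> 'a measure) \<Rightarrow> bool" where
  "filtered_extension P0 F0 P F \<longleftrightarrow>
     filtered_prob_space P0 F0 \<and> filtered_prob_space P F \<and>
     space P = space P0 \<and> sets P0 \<subseteq> sets P \<and> (\<forall>t\<ge>0. sets (F0 t) \<subseteq> sets (F t)) \<and>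
     (\<forall>A\<in>sets P0. emeasure P A = emeasure P0 A)"

definition natural_enlargement ::
  "'a measure \<Rightarrow> (real \<Rightarrow> 'a measure) \<Rightarrow> 'a measure \<Rightarrow> (real \<Rightarrow> 'a measure) \<Rightarrow> bool" where
  "natural_enlargement P0 F0 P F \<longleftrightarrow>
     filtered_extension P0 F0 P F \<and> natural_conditions P F \<and>
     (\<forall>P' F'. filtered_extension P0 F0 P' F' \<and> natural_conditions P' F' \<longrightarrow>
        filtered_extension P F P' F')"

definition filtration_atom :: "'a measure \<Rightarrow> 'a \<Rightarrow> 'a set" where
  "filtration_atom G x = \<Inter>{B \<in> sets G. x \<in> B}"

text \<open>Property (P) of a filtered measurable space: only the space and the \<open>\<sigma>\<close>-algebra of \<open>M\<close> are
  used.  A Polish space has at most the cardinality of the continuum, so up to homeomorphism its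
  points may be taken in \<^typ>\<open>real\<close>; the topology on them is arbitrary, not the Euclidean one.\<close>

definition property_P :: "'a measure \<Rightarrow> (real \<Rightarrow> 'a measure) \<Rightarrow> bool" where
  "property_P M F \<longleftrightarrow>
     filtered_space M F \<and>
     sets M = sigma_sets (space M) (\<Union>t\<in>{0..}. sets (F t)) \<and>
     (\<forall>t\<ge>0. \<exists>C. countable C \<and> C \<subseteq> Pow (space M) \<and> sets (F t) = sigma_sets (space M) C) \<and>
     (\<forall>t\<ge>0. \<exists>(T :: real topology) (p :: 'a \<Rightarrow> real).
        completely_metrizable_space T \<and> separable_space T \<and>
        p ` space M = topspace T \<and>
        sets (F t) = {p -` B \<inter> space M | B. B \<in> sigma_sets (topspace T) {U. openin T U}} \<and>
        (\<forall>B\<in>sets (F t). \<forall>x\<in>space M. p x \<in> p ` B \<longrightarrow> x \<in> B)) \<and>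
     (\<forall>w :: nat \<Rightarrow> 'a.
        range w \<subseteq> space M \<longrightarrow>
        (\<forall>N. (\<Inter>n\<in>{..N}. filtration_atom (F (real n)) (w n)) \<noteq> {}) \<longrightarrow>
        (\<Inter>n. filtration_atom (F (real n)) (w n)) \<noteq> {})"

definition property_NP :: "'a measure \<Rightarrow> (real \<Rightarrow> 'a measure) \<Rightarrow> bool" where
  "property_NP P F \<longleftrightarrow>
     (\<exists>P0 F0. filtered_prob_space P0 F0 \<and> property_P P0 F0 \<and> natural_enlargement P0 F0 P F)"


section \<open>Processes\<close>

definition adapted :: "(real \<Rightarrow> 'a measure) \<Rightarrow> (real \<Rightarrow> 'a \<Rightarrow> real) \<Rightarrow> bool" where
  "adapted F Y \<longleftrightarrow> (\<forall>t\<ge>0. Y t \<in> borel_measurable (F t))"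

definition cadlag_on :: "'a set \<Rightarrow> (real \<Rightarrow> 'a \<Rightarrow> real) \<Rightarrow> bool" where
  "cadlag_on S Y \<longleftrightarrow>
     (\<forall>x\<in>S. (\<forall>t\<ge>0. ((\<lambda>s. Y s x) \<longlongrightarrow> Y t x) (at_right t)) \<and>
             (\<forall>t>0. \<exists>l. ((\<lambda>s. Y s x) \<longlongrightarrow> l) (at_left t)))"

definition nonneg_on :: "'a set \<Rightarrow> (real \<Rightarrow> 'a \<Rightarrow> real) \<Rightarrow> bool" where
  "nonneg_on S Y \<longleftrightarrow> (\<forall>t\<ge>0. \<forall>x\<in>S. 0 \<le> Y t x)"

definition martingale ::
  "'a measure \<Rightarrow> (real \<Rightarrow> 'a measure) \<Rightarrow> (real \<Rightarrow> 'a \<Rightarrow> real) \<Rightarrow> bool" where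
  "martingale P F Y \<longleftrightarrow>
     adapted F Y \<and> (\<forall>t\<ge>0. integrable P (Y t)) \<and>
     (\<forall>s\<ge>0. \<forall>t\<ge>s. AE x in P. real_cond_exp P (F s) (Y t) x = Y s x)"

definition submartingale ::
  "'a measure \<Rightarrow> (real \<Rightarrow> 'a measure) \<Rightarrow> (real \<Rightarrow> 'a \<Rightarrow> real) \<Rightarrow> bool" where
  "submartingale P F Y \<longleftrightarrow>
     adapted F Y \<and> (\<forall>t\<ge>0. integrable P (Y t)) \<and>
     (\<forall>s\<ge>0. \<forall>t\<ge>s. AE x in P. Y s x \<le> real_cond_exp P (F s) (Y t) x)"

text \<open>\<open>X\<close> is of class \<open>(\<Sigma>)\<close> with decomposition \<open>X = N + A\<close>.  The Stieltjes measure \<open>dA\<close> of a path is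
  the interval measure of the path extended by \<open>A 0 = 0\<close> to negative times.\<close>

definition class_Sigma ::
  "'a measure \<Rightarrow> (real \<Rightarrow> 'a measure) \<Rightarrow> (real \<Rightarrow> 'a \<Rightarrow> real) \<Rightarrow>
   (real \<Rightarrow> 'a \<Rightarrow> real) \<Rightarrow> (real \<Rightarrow> 'a \<Rightarrow> real) \<Rightarrow> bool" where
  "class_Sigma P F X N A \<longleftrightarrow>
     submartingale P F X \<and> nonneg_on (space P) X \<and>
     (\<forall>t\<ge>0. \<forall>x\<in>space P. X t x = N t x + A t x) \<and>
     martingale P F N \<and> cadlag_on (space P) N \<and>
     adapted F A \<and>
     (\<forall>x\<in>space P. continuous_on {0..} (\<lambda>t. A t x) \<and> mono_on {0..} (\<lambda>t. A t x) \<and> A 0 x = 0) \<and>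
     (AE x in P. AE t in interval_measure (\<lambda>s. A (max 0 s) x). 0 \<le> t \<longrightarrow> X t x = 0)"

text \<open>The last zero \<open>g\<close>, with values in \<open>[0, \<infinity>]\<close>; in \<^typ>\<open>ennreal\<close> the supremum of the empty set
  is \<open>0\<close>.\<close>

definition last_zero :: "(real \<Rightarrow> 'a \<Rightarrow> real) \<Rightarrow> 'a \<Rightarrow> ennreal" where
  "last_zero X x = (SUP t\<in>{t. 0 \<le> t \<and> X t x = 0}. ennreal t)"

definition bounded_measurable :: "'a measure \<Rightarrow> ('a \<Rightarrow> real) \<Rightarrow> bool" where
  "bounded_measurable G f \<longleftrightarrow> f \<in> borel_measurable G \<and> (\<exists>c. \<forall>x\<in>space G. \<bar>f x\<bar> \<le> c)"


section \<open>The measures and martingales attached to a process\<close>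

text \<open>The measure \<open>Q\<close> associated with a submartingale of class \<open>(\<Sigma>)\<close>.  Measurability of the events
  \<open>g = \<infinity>\<close> and \<open>g \<le> t\<close>, automatic under (NP), is required explicitly, and
  \<^const>\<open>has_bochner_integral\<close> includes integrability: otherwise the conventions
  for non-measurable sets and non-integrable functions would make the equations degenerate.\<close>

definition Sigma_measure ::
  "'a measure \<Rightarrow> (real \<Rightarrow> 'a measure) \<Rightarrow> (real \<Rightarrow> 'a \<Rightarrow> real) \<Rightarrow> 'a measure \<Rightarrow> bool" where
  "Sigma_measure P F X Q \<longleftrightarrow>
     sets Q = sets P \<and> sigma_finite_measure Q \<and>
     {x \<in> space P. last_zero X x = \<infinity>} \<in> null_sets Q \<and>
     (\<forall>t\<ge>0. {x \<in> space P. last_zero X x \<le> ennreal t} \<in> sets P \<and>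
        (\<forall>f. bounded_measurable (F t) f \<longrightarrow>
           has_bochner_integral Q
             (\<lambda>x. f x * indicator {x \<in> space P. last_zero X x \<le> ennreal t} x)
             (\<integral>x. f x * X t x \<partial>P)))"

text \<open>\<open>R\<close> is the finite measure \<open>\<^bold>Q\<close> indexed by the process \<open>Y\<close>.  Almost sure nonnegativity of \<open>Y t\<close> is
  required explicitly because \<^const>\<open>ennreal\<close> truncates negative values.\<close>

definition measure_with_densities ::
  "'a measure \<Rightarrow> (real \<Rightarrow> 'a measure) \<Rightarrow> (real \<Rightarrow> 'a \<Rightarrow> real) \<Rightarrow> 'a measure \<Rightarrow> bool" where
  "measure_with_densities P F Y R \<longleftrightarrow>
     finite_measure R \<and> sets R = sets P \<and>
     (\<forall>t\<ge>0. Y t \<in> borel_measurable (F t) \<and> (AE x in P. 0 \<le> Y t x) \<and>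
        restr_to_subalg R (F t) =
        density (restr_to_subalg P (F t)) (\<lambda>x. ennreal (Y t x)))"

text \<open>\<open>M\<close> is a cadlag version of the martingale \<open>M\<^sub>t(f)\<close>.\<close>

definition Q_martingale ::
  "'a measure \<Rightarrow> (real \<Rightarrow> 'a measure) \<Rightarrow> 'a measure \<Rightarrow> ('a \<Rightarrow> real) \<Rightarrow>
   (real \<Rightarrow> 'a \<Rightarrow> real) \<Rightarrow> bool" where
  "Q_martingale P F Q f M \<longleftrightarrow>
     (AE x in Q. 0 \<le> f x) \<and> integrable Q f \<and>
     martingale P F M \<and> cadlag_on (space P) M \<and>
     (\<forall>t\<ge>0. \<forall>h. bounded_measurable (F t) h \<longrightarrow>
        (\<integral>x. f x * h x \<partial>Q) = (\<integral>x. h x * M t x \<partial>P))"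

definition cadlag_cond_exp ::
  "'a measure \<Rightarrow> (real \<Rightarrow> 'a measure) \<Rightarrow> ('a \<Rightarrow> real) \<Rightarrow> (real \<Rightarrow> 'a \<Rightarrow> real) \<Rightarrow> bool" where
  "cadlag_cond_exp P F f C \<longleftrightarrow>
     adapted F C \<and> cadlag_on (space P) C \<and>
     (\<forall>t\<ge>0. AE x in P. C t x = real_cond_exp P (F t) f x)"


section \<open>Decompositions of measures\<close>

definition mutually_singular :: "'a measure \<Rightarrow> 'a measure \<Rightarrow> bool" where
  "mutually_singular M N \<longleftrightarrow>
     sets M = sets N \<and>
     (\<exists>B\<in>sets M. emeasure M B = 0 \<and> emeasure N (space N - B) = 0)"

definition sum_of_three ::
  "'a measure \<Rightarrow> 'a measure \<Rightarrow> 'a measure \<Rightarrow> 'a measure \<Rightarrow> bool" where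
  "sum_of_three R M1 M2 M3 \<longleftrightarrow>
     sets M1 = sets R \<and> sets M2 = sets R \<and> sets M3 = sets R \<and>
     (\<forall>B\<in>sets R. emeasure R B = emeasure M1 B + emeasure M2 B + emeasure M3 B)"

text \<open>The library writes \<open>absolutely_continuous P M\<close> when \<open>M\<close> is absolutely continuous with respect to \<open>P\<close>.\<close>

definition ac_singular_decomposition ::
  "'a measure \<Rightarrow> 'a measure \<Rightarrow> 'a measure \<Rightarrow> 'a measure \<Rightarrow> 'a measure \<Rightarrow> 'a measure \<Rightarrow> bool" where
  "ac_singular_decomposition P Q R M1 M2 M3 \<longleftrightarrow>
     sum_of_three R M1 M2 M3 \<and>
     absolutely_continuous P M1 \<and> absolutely_continuous Q M2 \<and>
     mutually_singular M3 P \<and> mutually_singular M3 Q"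

end

theory Submission
  imports Defs
begin

text \<open>The densities are identified by a martingale argument: if finite measures \<open>\<kappa>\<close> and \<open>\<mu>\<close> have
  densities \<open>Y n\<close> and \<open>Z n\<close> on an increasing sequence of \<open>\<sigma>\<close>-algebras, then a \<open>\<kappa>\<close>-a.e. limit of
  \<open>Z n / Y n\<close> is the density of the absolutely continuous part of \<open>\<mu>\<close> with respect to \<open>\<kappa>\<close>.  This is
  applied to \<open>\<kappa> = P\<close>, and to the restriction of \<open>Q\<close> to \<open>{g \<le> s}\<close> for every integer \<open>s\<close>.  The point in
  the second case is that \<open>{g \<le> s}\<close> and \<open>{g \<le> t, A t = A s}\<close> are \<open>Q\<close>-a.e. equal for \<open>s \<le> t\<close>, so that
  this restriction has the density \<open>X t 1{A t = A s}\<close> on \<open>F t\<close>.  As \<open>g = \<infinity>\<close> holds \<open>P\<close>-a.s. and \<open>g < \<infinity>\<close>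
  holds \<open>Q\<close>-a.e., the two absolutely continuous parts do not overlap, and what remains of \<open>\<mu>\<close> is
  carried by a set that is null for both \<open>P\<close> and \<open>Q\<close>.\<close>

text \<open>Two obstacles shape the treatment of \<open>Q\<close>. When \<open>A\<close> increases
  to infinity, \<open>P\<close> and \<open>Q\<close> are carried by disjoint sets, so nothing true
  \<open>P\<close>-a.s. passes to \<open>Q\<close> directly; the only bridge is that on
  \<open>{g \<le> t}\<close> the events of \<open>F t\<close> have \<open>Q\<close>-mass given by
  the density \<open>X t\<close>. On the other hand \<open>{g \<le> s}\<close> depends on the whole
  future of the path and need not belong to any \<open>F t\<close>, so the restriction of
  \<open>Q\<close> to it has no evident density there. Replacing it by an event of
  \<open>F t\<close> intersected with \<open>{g \<le> t}\<close> cures this. One inclusion comes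
  from the support of \<open>dA\<close>, the other from comparing masses:
  \<open>Q[g \<le> t, A t = A s] = P[X t; A t = A s] \<le> P[X s] = Q[g \<le> s]\<close>, which is
  finite. The cut at \<open>s\<close> thus also supplies the finite measures that the martingale
  argument requires. The measure indexed by \<open>\<xi>\<close> is not built from its densities: it
  is the part of \<open>QZ\<close> on an exceptional set. Its densities are then found by
  subtraction, and their nonnegativity is a consequence.\<close>

section \<open>L1 approximation and convergence of closed martingales\<close>

text \<open>The functions that can be approximated form a vector space closed under dominated
  limits. It contains the indicators of the pi-system \<open>\<Union>n. sets (G n)\<close>, hence by
  a pi-lambda argument all measurable indicators, and then all integrable functions.\<close>

lemma integrable_L1_approx_subalgebra:
  fixes M :: "'a measure" and G :: "nat \<Rightarrow> 'a measure" and f :: "'a \<Rightarrow> real"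
  assumes fin: "finite_measure M"
    and sub: "\<And>n. subalgebra M (G n)"
    and mono: "\<And>m n. m \<le> n \<Longrightarrow> sets (G m) \<subseteq> sets (G n)"
    and gen: "sets M = sigma_sets (space M) (\<Union>n. sets (G n))"
    and f: "integrable M f"
  shows "\<forall>e>0. \<exists>n. \<exists>h\<in>borel_measurable (G n). integrable M h \<and> (\<integral>x. \<bar>f x - h x\<bar> \<partial>M) < e"
proof -
  interpret finite_measure M by fact
  define P where "P f \<longleftrightarrow> integrable M f \<and>
    (\<forall>e>0. \<exists>n. \<exists>h\<in>borel_measurable (G n). integrable M h \<and> (\<integral>x. \<bar>f x - h x\<bar> \<partial>M) < e)"
    for f :: "'a \<Rightarrow> real"
  have Pint: "P f \<Longrightarrow> integrable M f" for f unfolding P_def by simp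
  have Gm: "h \<in> borel_measurable (G n)" if "h \<in> borel_measurable (G m)" "m \<le> n"
    for h :: "'a \<Rightarrow> real" and m n
    by (rule measurable_from_subalg[OF _ that(1)])
      (use sub[of m] sub[of n] mono[OF that(2)] in \<open>auto simp: subalgebra_def\<close>)
  have P_basic: "P f" if "f \<in> borel_measurable (G n)" "integrable M f" for f n
    unfolding P_def using that by (auto intro!: exI[of _ n] bexI[of _ f])
  have P_add: "P (\<lambda>x. f x + g x)" if "P f" "P g" for f g
    unfolding P_def
  proof (intro conjI allI impI)
    show "integrable M (\<lambda>x. f x + g x)" using that by (auto simp: P_def)
    fix e :: real assume "e > 0"
    then have "e / 2 > 0" by simp
    obtain n h where h: "h \<in> borel_measurable (G n)" "integrable M h"
        "(\<integral>x. \<bar>f x - h x\<bar> \<partial>M) < e / 2"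
      using \<open>P f\<close> \<open>e / 2 > 0\<close> unfolding P_def by blast
    obtain m k where k: "k \<in> borel_measurable (G m)" "integrable M k"
        "(\<integral>x. \<bar>g x - k x\<bar> \<partial>M) < e / 2"
      using \<open>P g\<close> \<open>e / 2 > 0\<close> unfolding P_def by blast
    have "(\<integral>x. \<bar>(f x + g x) - (h x + k x)\<bar> \<partial>M) \<le> (\<integral>x. \<bar>f x - h x\<bar> + \<bar>g x - k x\<bar> \<partial>M)"
      using that h k by (intro integral_mono) (auto simp: P_def)
    also have "\<dots> = (\<integral>x. \<bar>f x - h x\<bar> \<partial>M) + (\<integral>x. \<bar>g x - k x\<bar> \<partial>M)"
      using that h k by (intro Bochner_Integration.integral_add) (auto simp: P_def)
    also have "\<dots> < e" using h k by simp
    finally have "(\<integral>x. \<bar>(f x + g x) - (h x + k x)\<bar> \<partial>M) < e" .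
    moreover have "(\<lambda>x. h x + k x) \<in> borel_measurable (G (max m n))"
      using Gm[OF h(1), of "max m n"] Gm[OF k(1), of "max m n"] by auto
    ultimately show "\<exists>n. \<exists>h\<in>borel_measurable (G n).
        integrable M h \<and> (\<integral>x. \<bar>f x + g x - h x\<bar> \<partial>M) < e"
      using h k by (intro exI[of _ "max m n"] bexI[of _ "\<lambda>x. h x + k x"]) auto
  qed
  have P_scale: "P (\<lambda>x. c * f x)" if "P f" for f c
  proof (cases "c = 0")
    case True
    then show ?thesis by (intro P_basic[of _ 0]) auto
  next
    case False
    show ?thesis unfolding P_def
    proof (intro conjI allI impI)
      show "integrable M (\<lambda>x. c * f x)" using that by (auto simp: P_def)
      fix e :: real assume "e > 0"
      then have "e / \<bar>c\<bar> > 0" using False by simp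
      then obtain n h where h: "h \<in> borel_measurable (G n)" "integrable M h"
          "(\<integral>x. \<bar>f x - h x\<bar> \<partial>M) < e / \<bar>c\<bar>"
        using \<open>P f\<close> unfolding P_def by blast
      have "(\<integral>x. \<bar>c * f x - c * h x\<bar> \<partial>M) = (\<integral>x. \<bar>c\<bar> * \<bar>f x - h x\<bar> \<partial>M)"
        by (simp add: abs_mult[symmetric] right_diff_distrib)
      also have "\<dots> < e" using h(3) False by (simp add: field_simps)
      finally show "\<exists>n. \<exists>h\<in>borel_measurable (G n).
          integrable M h \<and> (\<integral>x. \<bar>c * f x - h x\<bar> \<partial>M) < e"
        using h by (intro exI[of _ n] bexI[of _ "\<lambda>x. c * h x"]) auto
    qed
  qed
  have P_lim: "P f" if s: "\<And>i. P (s i)" and f: "integrable M f"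
    and lim: "(\<lambda>i. \<integral>x. \<bar>f x - s i x\<bar> \<partial>M) \<longlonglongrightarrow> 0" for f and s :: "nat \<Rightarrow> 'a \<Rightarrow> real"
    unfolding P_def
  proof (intro conjI allI impI f)
    fix e :: real assume "e > 0"
    then have "e / 2 > 0" by simp
    then have "eventually (\<lambda>i. (\<integral>x. \<bar>f x - s i x\<bar> \<partial>M) < e / 2) sequentially"
      by (rule order_tendstoD(2)[OF lim])
    then obtain i where i: "(\<integral>x. \<bar>f x - s i x\<bar> \<partial>M) < e / 2"
      by (auto simp: eventually_sequentially)
    obtain n h where h: "h \<in> borel_measurable (G n)" "integrable M h"
        "(\<integral>x. \<bar>s i x - h x\<bar> \<partial>M) < e / 2"
      using s[of i] \<open>e / 2 > 0\<close> unfolding P_def by blast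
    have "(\<integral>x. \<bar>f x - h x\<bar> \<partial>M) \<le> (\<integral>x. \<bar>f x - s i x\<bar> + \<bar>s i x - h x\<bar> \<partial>M)"
      using Pint[OF s] f h by (intro integral_mono) auto
    also have "\<dots> = (\<integral>x. \<bar>f x - s i x\<bar> \<partial>M) + (\<integral>x. \<bar>s i x - h x\<bar> \<partial>M)"
      using Pint[OF s] f h by (intro Bochner_Integration.integral_add) auto
    finally show "\<exists>n. \<exists>h\<in>borel_measurable (G n). integrable M h \<and> (\<integral>x. \<bar>f x - h x\<bar> \<partial>M) < e"
      using h i by (intro exI[of _ n] bexI[of _ h]) auto
  qed
  have P_pointwise: "P f" if s: "\<And>i. P (s i)" and f: "integrable M f"
    and lim: "\<And>x. x \<in> space M \<Longrightarrow> (\<lambda>i. s i x) \<longlonglongrightarrow> f x"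
    and w: "integrable M w" "\<And>i x. x \<in> space M \<Longrightarrow> \<bar>s i x\<bar> \<le> w x"
    for f w and s :: "nat \<Rightarrow> 'a \<Rightarrow> real"
  proof (rule P_lim[OF s f])
    have "(\<lambda>i. \<integral>x. \<bar>f x - s i x\<bar> \<partial>M) \<longlonglongrightarrow> (\<integral>x. 0 \<partial>M)"
    proof (rule integral_dominated_convergence[where w = "\<lambda>x. \<bar>f x\<bar> + w x"])
      have "(\<lambda>i. \<bar>f x - s i x\<bar>) \<longlonglongrightarrow> \<bar>f x - f x\<bar>" if "x \<in> space M" for x
        by (intro tendsto_intros lim that)
      then show "AE x in M. (\<lambda>i. \<bar>f x - s i x\<bar>) \<longlonglongrightarrow> 0" by auto
      show "AE x in M. norm \<bar>f x - s i x\<bar> \<le> \<bar>f x\<bar> + w x" for i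
        by (rule AE_I2) (use w(2)[of _ i] in \<open>fastforce\<close>)
    qed (use f w Pint[OF s] in auto)
    then show "(\<lambda>i. \<integral>x. \<bar>f x - s i x\<bar> \<partial>M) \<longlonglongrightarrow> 0" by simp
  qed
  have P_const: "P (\<lambda>x. c)" for c by (rule P_basic[of _ 0]) auto
  have P_set: "P (indicator B)" if "B \<in> sets M" for B
  proof -
    have "Int_stable (\<Union>n. sets (G n))"
    proof (rule Int_stableI)
      fix a b assume "a \<in> (\<Union>n. sets (G n))" "b \<in> (\<Union>n. sets (G n))"
      then obtain m n where "a \<in> sets (G m)" "b \<in> sets (G n)" by auto
      then have "a \<inter> b \<in> sets (G (max m n))"
        using mono[of m "max m n"] mono[of n "max m n"] by auto
      then show "a \<inter> b \<in> (\<Union>n. sets (G n))" by blast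
    qed
    moreover have "(\<Union>n. sets (G n)) \<subseteq> Pow (space M)"
      using sub by (auto simp: subalgebra_def dest!: sets.sets_into_space)
    moreover have "B \<in> sigma_sets (space M) (\<Union>n. sets (G n))" using that gen by simp
    ultimately show ?thesis
    proof (induction rule: sigma_sets_induct_disjoint)
      case (basic A)
      then obtain n where n: "A \<in> sets (G n)" by auto
      then have "A \<in> sets M" using sub[of n] by (auto simp: subalgebra_def)
      then show ?case using n by (intro P_basic[of _ n]) (auto simp: integrable_indicator_iff emeasure_eq_measure)
    next
      case empty
      show ?case using P_const[of 0] by (simp add: indicator_def)
    next
      case (compl A)
      then have A: "A \<in> sets M" using gen by simp
      have "P (\<lambda>x. 1 + (- 1) * indicator A x)"
        by (intro P_add P_const P_scale compl)
      then have "P (\<lambda>x. 1 - indicator A x)" by simp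
      \<comment> \<open>The function \<open>1 - indicator A\<close> agrees with the indicator of the
        complement only on \<open>space M\<close>. The constant sequence in \<open>P_lim\<close>
        absorbs the difference.\<close>
      then show ?case
      proof (rule P_lim[of "\<lambda>i x. 1 - indicator A x"])
        show "integrable M (indicator (space M - A) :: 'a \<Rightarrow> real)"
          using A by (auto simp: integrable_indicator_iff emeasure_eq_measure)
        have "(\<integral>x. \<bar>indicator (space M - A) x - (1 - indicator A x)\<bar> \<partial>M) = (\<integral>x. (0::real) \<partial>M)"
          by (rule Bochner_Integration.integral_cong) (auto simp: indicator_def)
        then show "(\<lambda>i. \<integral>x. \<bar>indicator (space M - A) x - (1 - indicator A x :: real)\<bar> \<partial>M) \<longlonglongrightarrow> 0"
          by simp
      qed
    next
      case (union A)
      then have A: "A i \<in> sets M" for i using gen by auto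
      have s: "P (\<lambda>x. \<Sum>i<n. indicator (A i) x)" for n
      proof (induction n)
        case 0 then show ?case using P_const[of 0] by simp
      next
        case (Suc n) then show ?case using P_add[OF Suc union(3)[of n]] by simp
      qed
      have eq: "(\<Sum>i<n. indicator (A i) x) = (indicator (\<Union>i<n. A i) x :: real)" for n x
        using union(1) by (subst indicator_UN_disjoint) (auto simp: disjoint_family_on_def)
      show ?case
      proof (rule P_pointwise[OF s, where w = "\<lambda>x. 1"])
        show "integrable M (indicator (\<Union> (range A)) :: 'a \<Rightarrow> real)"
          using A by (auto simp: integrable_indicator_iff emeasure_eq_measure)
        show "(\<lambda>n. \<Sum>i<n. indicator (A i) x) \<longlonglongrightarrow> (indicator (\<Union> (range A)) x :: real)" for x
          unfolding eq by (rule LIMSEQ_indicator_UN)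
        show "\<bar>\<Sum>i<n. indicator (A i) x\<bar> \<le> (1::real)" for n x
          unfolding eq by (simp add: indicator_def)
      qed simp
    qed
  qed
  have "P f" using f
  proof (induction rule: integrable_induct)
    case (base A c)
    then show ?case using P_scale[OF P_set[of A], of c] by (simp add: mult.commute)
  next
    case (add f g) then show ?case by (intro P_add) auto
  next
    case (lim f s)
    show ?case by (rule P_pointwise[of s _ "\<lambda>x. 2 * \<bar>f x\<bar>"]) (use lim in auto)
  qed
  then show ?thesis unfolding P_def by blast
qed

text \<open>The assumptions on \<open>c n\<close> characterise the conditional expectation of
  \<open>f\<close> given \<open>G n\<close>. Conditioning contracts the L1 distance to
  \<open>G n\<close>-measurable functions, so one approximation of \<open>f\<close> at level
  \<open>m\<close> controls the error at every later level.\<close>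

lemma levy_upward_L1:
  fixes M :: "'a measure" and G :: "nat \<Rightarrow> 'a measure" and f :: "'a \<Rightarrow> real"
  assumes fin: "finite_measure M"
    and sub: "\<And>n. subalgebra M (G n)"
    and mono: "\<And>m n. m \<le> n \<Longrightarrow> sets (G m) \<subseteq> sets (G n)"
    and gen: "sets M = sigma_sets (space M) (\<Union>n. sets (G n))"
    and f: "integrable M f"
    and c: "\<And>n. c n \<in> borel_measurable (G n)" "\<And>n. integrable M (c n)"
      "\<And>n E. E \<in> sets (G n) \<Longrightarrow> (\<integral>x\<in>E. c n x \<partial>M) = (\<integral>x\<in>E. f x \<partial>M)"
  shows "(\<lambda>n. \<integral>x. \<bar>c n x - f x\<bar> \<partial>M) \<longlonglongrightarrow> 0"
proof (rule LIMSEQ_I)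
  fix e :: real assume "e > 0"
  then have "e / 2 > 0" by simp
  then obtain m h where h: "h \<in> borel_measurable (G m)" "integrable M h"
      "(\<integral>x. \<bar>f x - h x\<bar> \<partial>M) < e / 2"
    using integrable_L1_approx_subalgebra[OF fin sub mono gen f] by blast
  have "norm ((\<integral>x. \<bar>c n x - f x\<bar> \<partial>M) - 0) < e" if "n \<ge> m" for n
  proof -
    have hn[measurable]: "h \<in> borel_measurable (G n)"
      by (rule measurable_from_subalg[OF _ h(1)])
        (use sub[of m] sub[of n] mono[OF that] in \<open>auto simp: subalgebra_def\<close>)
    have cn[measurable]: "c n \<in> borel_measurable (G n)" by (rule c)
    \<comment> \<open>On \<open>E\<close> and on its complement \<open>c n - h\<close> has constant
      sign. Both sets lie in \<open>G n\<close>, so on each of them the integral of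
      \<open>c n\<close> may be replaced by that of \<open>f\<close>.\<close>
    define E where "E = {x \<in> space (G n). h x \<le> c n x}"
    have E: "E \<in> sets (G n)" "space M - E \<in> sets (G n)"
    proof -
      show "E \<in> sets (G n)" unfolding E_def by measurable
      then show "space M - E \<in> sets (G n)" using sub[of n] sets.compl_sets[of E "G n"] by (simp add: subalgebra_def)
    qed
    then have EM: "E \<in> sets M" "space M - E \<in> sets M" using sub[of n] by (auto simp: subalgebra_def)
    have i: "set_integrable M B g" if "B \<in> sets M" "integrable M g" for B and g :: "'a \<Rightarrow> real"
      using that unfolding set_integrable_def by (intro integrable_mult_indicator) auto
    have split: "(\<integral>x. g x \<partial>M) = (\<integral>x\<in>E. g x \<partial>M) + (\<integral>x\<in>space M - E. g x \<partial>M)"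
      if "integrable M g" for g :: "'a \<Rightarrow> real"
    proof -
      have "(\<integral>x. g x \<partial>M) = (\<integral>x\<in>space M. g x \<partial>M)"
        by (simp add: set_integral_space that)
      also have "space M = E \<union> (space M - E)" using EM sets.sets_into_space by auto
      also have "(\<integral>x\<in>E \<union> (space M - E). g x \<partial>M)
          = (\<integral>x\<in>E. g x \<partial>M) + (\<integral>x\<in>space M - E. g x \<partial>M)"
        by (rule set_integral_Un) (use EM that i in auto)
      finally show ?thesis .
    qed
    have "(\<integral>x. \<bar>c n x - h x\<bar> \<partial>M)
        = (\<integral>x\<in>E. \<bar>c n x - h x\<bar> \<partial>M) + (\<integral>x\<in>space M - E. \<bar>c n x - h x\<bar> \<partial>M)"
      using c h by (intro split) auto
    also have "\<dots> = (\<integral>x\<in>E. c n x - h x \<partial>M) + (\<integral>x\<in>space M - E. h x - c n x \<partial>M)"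
      unfolding set_lebesgue_integral_def using sub[of n]
      by (intro arg_cong2[where f = "(+)"] Bochner_Integration.integral_cong)
        (auto simp: E_def indicator_def subalgebra_def)
    also have "\<dots> = (\<integral>x\<in>E. f x - h x \<partial>M) + (\<integral>x\<in>space M - E. h x - f x \<partial>M)"
      using EM c(2) h f by (simp add: set_integral_diff i c(3)[OF E(1)] c(3)[OF E(2)])
    also have "\<dots> \<le> (\<integral>x\<in>E. \<bar>f x - h x\<bar> \<partial>M) + (\<integral>x\<in>space M - E. \<bar>f x - h x\<bar> \<partial>M)"
      using EM h f by (intro add_mono set_integral_mono i) auto
    also have "\<dots> = (\<integral>x. \<bar>f x - h x\<bar> \<partial>M)" using h f by (subst split) auto
    also have "\<dots> < e / 2" by (rule h)
    finally have 1: "(\<integral>x. \<bar>c n x - h x\<bar> \<partial>M) < e / 2" .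
    have "(\<integral>x. \<bar>c n x - f x\<bar> \<partial>M) \<le> (\<integral>x. \<bar>c n x - h x\<bar> + \<bar>f x - h x\<bar> \<partial>M)"
      using c(2) h f by (intro integral_mono) auto
    also have "\<dots> = (\<integral>x. \<bar>c n x - h x\<bar> \<partial>M) + (\<integral>x. \<bar>f x - h x\<bar> \<partial>M)"
      using c(2) h f by (intro Bochner_Integration.integral_add) auto
    finally show ?thesis using 1 h(3) by (simp add: integral_nonneg_AE)
  qed
  then show "\<exists>N. \<forall>n\<ge>N. norm ((\<integral>x. \<bar>c n x - f x\<bar> \<partial>M) - 0) < e" by blast
qed

section \<open>Absolutely continuous parts as limits of density ratios\<close>

lemma ex_sum_of_finite_measures:
  fixes M N :: "'a measure"
  assumes "finite_measure M" "finite_measure N" "sets N = sets M"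
  obtains S where "finite_measure S" "sets S = sets M"
    "\<And>B. B \<in> sets M \<Longrightarrow> emeasure S B = emeasure M B + emeasure N B"
proof
  define S where "S = measure_of (space M) (sets M) (\<lambda>B. emeasure M B + emeasure N B)"
  show sets: "sets S = sets M" by (simp add: S_def)
  show S: "emeasure S B = emeasure M B + emeasure N B" if "B \<in> sets M" for B
  proof (rule emeasure_measure_of[OF S_def])
    show "countably_additive (sets S) (\<lambda>B. emeasure M B + emeasure N B)"
      using assms(3) by (auto simp: countably_additive_def sets suminf_add[symmetric] suminf_emeasure)
  qed (use that in \<open>auto simp: positive_def sets dest: sets.sets_into_space\<close>)
  have "emeasure S (space S) \<noteq> \<infinity>"
    using S[of "space M"] finite_measure.emeasure_finite[OF assms(1)]
      finite_measure.emeasure_finite[OF assms(2)] sets_eq_imp_space_eq[OF sets] by simp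
  then show "finite_measure S" by (rule finite_measureI)
qed

lemma ennreal_indicator_mult: "ennreal (y * indicator E x) = ennreal y * indicator E x"
  by (cases "x \<in> E") simp_all

lemma nn_integral_density_subalgebra:
  assumes "subalgebra P G" "subalgebra R G"
    and d: "restr_to_subalg R G = density (restr_to_subalg P G) Y"
    and [measurable]: "Y \<in> borel_measurable G" "f \<in> borel_measurable G"
  shows "(\<integral>\<^sup>+x. f x \<partial>R) = (\<integral>\<^sup>+x. Y x * f x \<partial>P)"
proof -
  have "(\<integral>\<^sup>+x. f x \<partial>R) = (\<integral>\<^sup>+x. f x \<partial>restr_to_subalg R G)"
    by (rule nn_integral_subalgebra2[symmetric]) (use assms in auto)
  also have "\<dots> = (\<integral>\<^sup>+x. Y x * f x \<partial>restr_to_subalg P G)"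
    unfolding d using assms by (intro nn_integral_density) (auto intro: measurable_in_subalg)
  also have "\<dots> = (\<integral>\<^sup>+x. Y x * f x \<partial>P)"
    using assms by (intro nn_integral_subalgebra2) auto
  finally show ?thesis .
qed

text \<open>The idea is to work under the dominating measure \<open>\<kappa> + \<mu>\<close>: the densities
  \<open>Y n / (Y n + Z n)\<close> of \<open>\<kappa>\<close> on the subalgebras are bounded, so they converge in \<open>L\<^sup>1\<close> to the
  density \<open>k\<close> of \<open>\<kappa>\<close>, which is therefore \<open>1 / (1 + w)\<close>.  The exceptional set is \<open>k = 0\<close>.\<close>

lemma ac_part_eq_limit_of_density_ratio:
  fixes P \<kappa> \<mu> :: "'a measure" and G :: "nat \<Rightarrow> 'a measure" and Y Z :: "nat \<Rightarrow> 'a \<Rightarrow> real"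
  assumes fin: "finite_measure \<kappa>" "finite_measure \<mu>"
    and sets: "sets \<kappa> = sets P" "sets \<mu> = sets P"
    and sub: "\<And>n. subalgebra P (G n)"
    and mono: "\<And>m n. m \<le> n \<Longrightarrow> sets (G m) \<subseteq> sets (G n)"
    and gen: "sets P = sigma_sets (space P) (\<Union>n. sets (G n))"
    and Y: "\<And>n. Y n \<in> borel_measurable (G n)" "\<And>n x. x \<in> space P \<Longrightarrow> 0 \<le> Y n x"
      "\<And>n. restr_to_subalg \<kappa> (G n) = density (restr_to_subalg P (G n)) (\<lambda>x. ennreal (Y n x))"
    and Z: "\<And>n. Z n \<in> borel_measurable (G n)" "\<And>n x. x \<in> space P \<Longrightarrow> 0 \<le> Z n x"
      "\<And>n. restr_to_subalg \<mu> (G n) = density (restr_to_subalg P (G n)) (\<lambda>x. ennreal (Z n x))"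
    and w: "AE x in \<kappa>. (\<lambda>n. Z n x / Y n x) \<longlonglongrightarrow> w x"
    and w_meas: "w \<in> borel_measurable P"
  shows "\<exists>B\<in>sets P. emeasure \<kappa> B = 0 \<and>
    (\<forall>C\<in>sets P. emeasure \<mu> (C - B) = emeasure (density \<kappa> (\<lambda>x. ennreal (w x))) C)"
proof -
  obtain \<nu> where \<nu>: "finite_measure \<nu>" "sets \<nu> = sets \<kappa>"
    "\<And>B. B \<in> sets \<kappa> \<Longrightarrow> emeasure \<nu> B = emeasure \<kappa> B + emeasure \<mu> B"
    using ex_sum_of_finite_measures[OF fin] sets by metis
  interpret K: finite_measure \<kappa> by fact
  interpret M: finite_measure \<mu> by fact
  interpret V: finite_measure \<nu> by fact
  note [measurable_cong] = \<nu>(2) sets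
  have space: "space \<kappa> = space P" "space \<mu> = space P" "space \<nu> = space P"
    using sets \<nu>(2) by (auto dest: sets_eq_imp_space_eq)
  have subs: "subalgebra \<kappa> (G n)" "subalgebra \<mu> (G n)" "subalgebra \<nu> (G n)" for n
    using sub[of n] sets \<nu>(2) space by (auto simp: subalgebra_def)
  have [measurable]: "w \<in> borel_measurable P" "\<And>n. Y n \<in> borel_measurable P" "\<And>n. Z n \<in> borel_measurable P"
    using w_meas measurable_from_subalg[OF sub Y(1)] measurable_from_subalg[OF sub Z(1)] by auto
  have spG: "space (G n) = space P" for n using sub[of n] by (simp add: subalgebra_def)
  have ac: "absolutely_continuous \<nu> \<kappa>"
    using \<nu> by (auto simp: absolutely_continuous_def null_sets_def)
  obtain k0 where k0[measurable]: "k0 \<in> borel_measurable \<nu>" and dk0: "density \<nu> k0 = \<kappa>"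
    using V.Radon_Nikodym[OF ac \<nu>(2)[symmetric]] by blast
  have acm: "absolutely_continuous \<nu> \<mu>"
    using \<nu> sets by (auto simp: absolutely_continuous_def null_sets_def)
  obtain m0 where m0[measurable]: "m0 \<in> borel_measurable \<nu>" and dm0: "density \<nu> m0 = \<mu>"
    using V.Radon_Nikodym[OF acm] \<nu>(2) sets by auto
  have "density \<nu> (\<lambda>x. k0 x + m0 x) = density \<nu> (\<lambda>x. 1)"
  proof (rule measure_eqI)
    fix E assume "E \<in> sets (density \<nu> (\<lambda>x. k0 x + m0 x))"
    then have E[measurable]: "E \<in> sets \<nu>" by simp
    have "emeasure (density \<nu> (\<lambda>x. k0 x + m0 x)) E = emeasure (density \<nu> k0) E + emeasure (density \<nu> m0) E"
      by (simp add: emeasure_density distrib_right nn_integral_add)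
    also have "\<dots> = emeasure (density \<nu> (\<lambda>x. 1)) E"
      using \<nu> E by (simp add: dk0 dm0 density_1)
    finally show "emeasure (density \<nu> (\<lambda>x. k0 x + m0 x)) E = emeasure (density \<nu> (\<lambda>x. 1)) E" .
  qed simp
  then have km: "AE x in \<nu>. k0 x + m0 x = 1"
    by (subst (asm) V.density_unique_iff) auto
  define k where "k x = enn2real (k0 x)" for x
  have [measurable]: "k \<in> borel_measurable \<nu>" unfolding k_def by measurable
  have k: "AE x in \<nu>. k0 x = ennreal (k x) \<and> m0 x = ennreal (1 - k x) \<and> k x \<le> 1"
    using km
  proof eventually_elim
    case (elim x)
    then have f: "k0 x \<noteq> \<infinity>" "m0 x \<noteq> \<infinity>" by auto
    then obtain a b where ab: "k0 x = ennreal a" "0 \<le> a" "m0 x = ennreal b" "0 \<le> b"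
      by (metis ennreal_cases infinity_ennreal_def)
    then have "a + b = 1" using elim by (simp add: ennreal_plus[symmetric] del: ennreal_plus)
    then show ?case using ab by (auto simp: k_def)
  qed
  have YG: "(\<lambda>x. ennreal (Y n x)) \<in> borel_measurable (G n)"
    and ZG: "(\<lambda>x. ennreal (Z n x)) \<in> borel_measurable (G n)" for n
    using Y(1) Z(1) by measurable
  have k_nn: "0 \<le> k x" for x by (simp add: k_def)
  have kint: "integrable \<nu> k"
    using k by (intro V.integrable_const_bound[of _ 1]) (auto simp: k_nn elim: eventually_mono)
  \<comment> \<open>Where both densities vanish, division by zero gives \<open>c n x = 0\<close>,
    and the identity \<open>Y n x * c n x + Z n x * c n x = Y n x\<close> used below still
    holds.\<close>
  define c where "c n x = Y n x / (Y n x + Z n x)" for n x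
  have cG: "c n \<in> borel_measurable (G n)" for n unfolding c_def using Y(1) Z(1) by measurable
  have [measurable]: "c n \<in> borel_measurable \<nu>" for n
    using measurable_from_subalg[OF subs(3) cG] .
  have c01: "0 \<le> c n x" "c n x \<le> 1" if "x \<in> space P" for n x
    using Y(2)[OF that, of n] Z(2)[OF that, of n] by (auto simp: c_def divide_simps)
  have cint: "integrable \<nu> (c n)" for n
    by (intro V.integrable_const_bound[of _ 1] AE_I2) (auto simp: space c01)
  have split: "(\<integral>\<^sup>+x. f x \<partial>\<nu>) = (\<integral>\<^sup>+x. f x \<partial>\<kappa>) + (\<integral>\<^sup>+x. f x \<partial>\<mu>)"
    if [measurable]: "f \<in> borel_measurable \<nu>" for f
  proof -
    have "(\<integral>\<^sup>+x. f x \<partial>\<nu>) = (\<integral>\<^sup>+x. k0 x * f x + m0 x * f x \<partial>\<nu>)"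
      using km by (intro nn_integral_cong_AE) (auto simp: distrib_right[symmetric])
    also have "\<dots> = (\<integral>\<^sup>+x. f x \<partial>\<kappa>) + (\<integral>\<^sup>+x. f x \<partial>\<mu>)"
      unfolding dk0[symmetric] dm0[symmetric] by (simp add: nn_integral_add nn_integral_density)
    finally show ?thesis .
  qed
  have c_eq: "(\<integral>x\<in>E. c n x \<partial>\<nu>) = (\<integral>x\<in>E. k x \<partial>\<nu>)" if E: "E \<in> sets (G n)" for n E
  proof -
    have EP[measurable]: "E \<in> sets P" using E sub[of n] by (auto simp: subalgebra_def)
    have m[measurable]: "(\<lambda>x. ennreal (c n x) * indicator E x) \<in> borel_measurable (G n)"
      using E cG by measurable
    have "(\<integral>\<^sup>+x. ennreal (c n x) * indicator E x \<partial>\<nu>)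
        = (\<integral>\<^sup>+x. ennreal (Y n x) * (ennreal (c n x) * indicator E x) \<partial>P)
          + (\<integral>\<^sup>+x. ennreal (Z n x) * (ennreal (c n x) * indicator E x) \<partial>P)"
      using nn_integral_density_subalgebra[OF sub subs(1) Y(3) YG m]
        nn_integral_density_subalgebra[OF sub subs(2) Z(3) ZG m]
      by (subst split) auto
    also have "\<dots> = (\<integral>\<^sup>+x. ennreal (Y n x) * (ennreal (c n x) * indicator E x)
          + ennreal (Z n x) * (ennreal (c n x) * indicator E x) \<partial>P)"
      using measurable_from_subalg[OF sub m] by (intro nn_integral_add[symmetric]) auto
    also have "\<dots> = (\<integral>\<^sup>+x. ennreal (Y n x) * indicator E x \<partial>P)"
    proof (rule nn_integral_cong)
      fix x assume x: "x \<in> space P"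
      have "Y n x * c n x + Z n x * c n x = Y n x"
        using Y(2)[OF x, of n] Z(2)[OF x, of n]
        by (cases "Y n x + Z n x = 0") (auto simp: c_def add_divide_distrib[symmetric] distrib_right[symmetric])
      then have "ennreal (Y n x) * ennreal (c n x) + ennreal (Z n x) * ennreal (c n x) = ennreal (Y n x)"
        using Y(2)[OF x, of n] Z(2)[OF x, of n] c01[OF x, of n]
        by (simp add: ennreal_mult[symmetric] ennreal_plus[symmetric] del: ennreal_plus)
      then show "ennreal (Y n x) * (ennreal (c n x) * indicator E x)
          + ennreal (Z n x) * (ennreal (c n x) * indicator E x) = ennreal (Y n x) * indicator E x"
        by (simp add: indicator_def)
    qed
    also have "\<dots> = (\<integral>\<^sup>+x. indicator E x \<partial>\<kappa>)"
      using E by (intro nn_integral_density_subalgebra[OF sub subs(1) Y(3) YG, symmetric]) auto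
    also have "\<dots> = (\<integral>\<^sup>+x. k0 x * indicator E x \<partial>\<nu>)"
      unfolding dk0[symmetric] by (simp add: emeasure_density)
    also have "\<dots> = (\<integral>\<^sup>+x. ennreal (k x) * indicator E x \<partial>\<nu>)"
      using k by (intro nn_integral_cong_AE) auto
    finally have eq: "(\<integral>\<^sup>+x. ennreal (c n x * indicator E x) \<partial>\<nu>) = (\<integral>\<^sup>+x. ennreal (k x * indicator E x) \<partial>\<nu>)"
      unfolding ennreal_indicator_mult .
    have "(\<integral>x. c n x * indicator E x \<partial>\<nu>) = (\<integral>x. k x * indicator E x \<partial>\<nu>)"
      using eq by (subst (1 2) integral_eq_nn_integral) (auto simp: k_nn c01 space indicator_def)
    then show ?thesis by (simp add: set_lebesgue_integral_def mult.commute)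
  qed
  have "(\<lambda>n. \<integral>x. \<bar>c n x - k x\<bar> \<partial>\<nu>) \<longlonglongrightarrow> 0"
    using cG cint c_eq gen \<nu>(2) sets space kint
    by (intro levy_upward_L1[OF \<nu>(1) subs(3) mono]) auto
  \<comment> \<open>A subsequence is enough: the full sequence of ratios converges by assumption,
    and only its limit has to be identified.\<close>
  then obtain r :: "nat \<Rightarrow> nat" where r: "strict_mono r" "AE x in \<nu>. (\<lambda>n. c (r n) x - k x) \<longlonglongrightarrow> 0"
    using tendsto_L1_AE_subseq[of \<nu> "\<lambda>n x. c n x - k x"] cint kint by auto
  \<comment> \<open>Positivity excludes the default value of division by zero, so that
    \<open>c n\<close> is truly \<open>1 / (1 + Z n / Y n)\<close>.\<close>
  have Ypos: "AE x in \<kappa>. 0 < Y n x" for n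
  proof -
    have E: "{x \<in> space P. Y n x = 0} \<in> sets (G n)"
      using Y(1)[of n] unfolding spG[of n, symmetric] by measurable
    have "emeasure \<kappa> {x \<in> space P. Y n x = 0} = (\<integral>\<^sup>+x. indicator {x \<in> space P. Y n x = 0} x \<partial>\<kappa>)"
      by simp
    also have "\<dots> = (\<integral>\<^sup>+x. ennreal (Y n x) * indicator {x \<in> space P. Y n x = 0} x \<partial>P)"
      using E by (intro nn_integral_density_subalgebra[OF sub subs(1) Y(3) YG]) auto
    also have "\<dots> = (\<integral>\<^sup>+x. 0 \<partial>P)" by (intro nn_integral_cong) (auto simp: indicator_def)
    finally have "AE x in \<kappa>. Y n x \<noteq> 0" by (subst AE_iff_null) (auto simp: space null_sets_def)
    then show ?thesis using Y(2) by (elim AE_mp) (auto intro!: AE_I2 simp: space less_le)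
  qed
  have "AE x in \<kappa>. (\<lambda>n. c (r n) x - k x) \<longlonglongrightarrow> 0"
    by (rule absolutely_continuous_AE[OF \<nu>(2)[symmetric] ac r(2)])
  moreover have "AE x in \<kappa>. \<forall>n. 0 < Y n x" using Ypos by (simp add: AE_all_countable)
  ultimately have wk: "AE x in \<kappa>. w x \<ge> 0 \<and> k x = 1 / (1 + w x)"
    using w AE_space
  proof eventually_elim
    case (elim x)
    then have x: "x \<in> space P" by (simp add: space)
    have w0: "0 \<le> w x"
      using elim(3) by (rule LIMSEQ_le_const) (use Y(2)[OF x] Z(2)[OF x] in auto)
    have "c n x = 1 / (1 + Z n x / Y n x)" for n
      using elim(2)[rule_format, of n] by (simp add: c_def divide_simps)
    moreover have "(\<lambda>n. 1 / (1 + Z (r n) x / Y (r n) x)) \<longlonglongrightarrow> 1 / (1 + w x)"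
      using w0 LIMSEQ_subseq_LIMSEQ[OF elim(3) r(1)] by (intro tendsto_intros) (auto simp: o_def)
    moreover have "(\<lambda>n. c (r n) x) \<longlonglongrightarrow> k x" using elim(1) by (simp add: LIM_zero_iff)
    ultimately have "k x = 1 / (1 + w x)" by (auto intro: LIMSEQ_unique)
    then show ?case using w0 by simp
  qed
  \<comment> \<open>The relation is known only \<open>\<kappa>\<close>-a.e.; read through the
    density \<open>k0\<close> it holds \<open>\<nu>\<close>-a.e. where \<open>k\<close> is
    positive.\<close>
  have wk': "AE x in \<nu>. 0 < k x \<longrightarrow> 0 \<le> w x \<and> k x * w x = 1 - k x"
  proof -
    have "AE x in \<nu>. 0 < k0 x \<longrightarrow> w x \<ge> 0 \<and> k x = 1 / (1 + w x)"
      using wk unfolding dk0[symmetric] by (subst (asm) AE_density) auto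
    then show ?thesis using k by eventually_elim (auto simp: field_simps)
  qed
  define B where "B = {x \<in> space \<nu>. k x = 0}"
  have [measurable]: "B \<in> sets \<nu>" unfolding B_def by measurable
  show ?thesis
  proof (intro bexI[of _ B] conjI ballI)
    show "B \<in> sets P" using \<open>B \<in> sets \<nu>\<close> \<nu>(2) sets by simp
    have "emeasure \<kappa> B = (\<integral>\<^sup>+x. k0 x * indicator B x \<partial>\<nu>)"
      unfolding dk0[symmetric] by (simp add: emeasure_density)
    also have "\<dots> = (\<integral>\<^sup>+x. 0 \<partial>\<nu>)"
      using k by (intro nn_integral_cong_AE) (auto simp: B_def indicator_def elim: eventually_mono)
    finally show "emeasure \<kappa> B = 0" by simp
    fix C assume [measurable]: "C \<in> sets P"
    \<comment> \<open>Off \<open>B\<close> the density of \<open>\<mu>\<close> is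
      \<open>1 - k = k * w\<close>, which is also the density with respect to \<open>\<nu>\<close>
      of the measure with density \<open>w\<close> with respect to \<open>\<kappa>\<close>. On
      \<open>B\<close> both sides vanish.\<close>
    have "AE x in \<nu>. m0 x * indicator (C - B) x = k0 x * (ennreal (w x) * indicator C x)"
      using k wk' AE_space
    proof eventually_elim
      case (elim x)
      show ?case
      proof (cases "k x = 0")
        case False
        then have "0 < k x" using k_nn[of x] by simp
        then have "k0 x * ennreal (w x) = m0 x"
          using elim by (simp add: ennreal_mult[symmetric])
        then show ?thesis using False by (simp add: B_def indicator_def)
      qed (use elim in \<open>auto simp: B_def indicator_def\<close>)
    qed
    then have "emeasure \<mu> (C - B) = (\<integral>\<^sup>+x. k0 x * (ennreal (w x) * indicator C x) \<partial>\<nu>)"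
      unfolding dm0[symmetric] by (simp add: emeasure_density nn_integral_cong_AE)
    also have "\<dots> = emeasure (density \<kappa> (\<lambda>x. ennreal (w x))) C"
      by (subst emeasure_density) (auto simp: nn_integral_density dk0[symmetric])
    finally show "emeasure \<mu> (C - B) = emeasure (density \<kappa> (\<lambda>x. ennreal (w x))) C" .
  qed
qed

section \<open>Uniform partitions and Stieltjes integrals along a path\<close>

definition grid :: "real \<Rightarrow> real \<Rightarrow> nat \<Rightarrow> nat \<Rightarrow> real" where
  "grid s t n i = s + real i * (t - s) / real n"

lemma grid_0 [simp]: "grid s t n 0 = s"
  by (simp add: grid_def)

lemma grid_end [simp]: "0 < n \<Longrightarrow> grid s t n n = t"
  by (simp add: grid_def)

lemma grid_mono: "s \<le> t \<Longrightarrow> i \<le> j \<Longrightarrow> grid s t n i \<le> grid s t n j"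
  by (simp add: grid_def divide_right_mono mult_right_mono)

lemma grid_bounds:
  assumes "s \<le> t" "i \<le> n"
  shows "s \<le> grid s t n i" "grid s t n i \<le> t"
proof -
  show "s \<le> grid s t n i" using grid_mono[OF assms(1), of 0 i n] by simp
  show "grid s t n i \<le> t"
    using grid_mono[OF assms, of n] assms by (cases "n = 0") auto
qed

lemma grid_Suc: "grid s t n (Suc i) = grid s t n i + (t - s) / real n"
  by (simp add: grid_def ring_distribs add_divide_distrib diff_divide_distrib)

lemma grid_cell:
  assumes "s < v" "v \<le> t" "0 < n"
  obtains i where "i < n" "grid s t n i < v" "v \<le> grid s t n (Suc i)"
proof -
  define j where "j = (LEAST j. v \<le> grid s t n j)"
  have "v \<le> grid s t n n" using assms by simp
  then have j: "v \<le> grid s t n j" "j \<le> n" unfolding j_def by (auto intro: LeastI Least_le)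
  have "j \<noteq> 0" using j(1) assms(1) by (cases j) auto
  then obtain i where i: "j = Suc i" by (cases j) auto
  moreover have "grid s t n i < v"
    using not_less_Least[of i "\<lambda>j. v \<le> grid s t n j"] i by (simp add: j_def not_le)
  ultimately show ?thesis using j that[of i] by simp
qed

lemma tendsto_mesh: "(\<lambda>n. c / real (Suc n)) \<longlonglongrightarrow> 0"
  using LIMSEQ_Suc[OF lim_const_over_n[of c]] by simp

lemma Stieltjes_Ioc:
  fixes a :: "real \<Rightarrow> real"
  assumes "mono_on {0..} a" "continuous_on {0..} a" "0 \<le> s" "s \<le> t"
  shows "emeasure (interval_measure (\<lambda>u. a (max 0 u))) {s<..t} = ennreal (a t - a s)"
    and "measure (interval_measure (\<lambda>u. a (max 0 u))) {s<..t} = a t - a s"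
proof -
  have "continuous_on UNIV (\<lambda>u. a (max 0 u))"
    by (intro continuous_on_compose2[OF assms(2)] continuous_intros) auto
  then have "continuous (at_right u) (\<lambda>u. a (max 0 u))" for u
    by (simp add: continuous_on_eq_continuous_at continuous_at_imp_continuous_within)
  moreover have "a (max 0 u) \<le> a (max 0 v)" if "u \<le> v" for u v
    using assms(1) that by (intro mono_onD[OF assms(1)]) auto
  ultimately show e: "emeasure (interval_measure (\<lambda>u. a (max 0 u))) {s<..t} = ennreal (a t - a s)"
    using assms(3,4) by (subst emeasure_interval_measure_Ioc) auto
  have "a s \<le> a t" using assms by (intro mono_onD[OF assms(1)]) auto
  then show "measure (interval_measure (\<lambda>u. a (max 0 u))) {s<..t} = a t - a s"
    by (simp add: measure_def e)
qed

text \<open>Sampling \<open>x\<close> at the right end of each cell makes the sample points approach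
  every point from the right, so right-continuity of \<open>x\<close> suffices. Domination is by the
  indicator of \<open>{s<..t}\<close>, which has finite mass. The sums will show that such a path
  integral is measurable at time \<open>t\<close>.\<close>

lemma Riemann_Stieltjes_right_continuous:
  fixes a x :: "real \<Rightarrow> real"
  defines "\<mu> \<equiv> interval_measure (\<lambda>u. a (max 0 u))"
  assumes a: "mono_on {0..} a" "continuous_on {0..} a" and st: "0 \<le> s" "s \<le> t"
    and x: "\<And>u. 0 \<le> u \<Longrightarrow> (x \<longlongrightarrow> x u) (at_right u)" "\<And>u. 0 \<le> u \<Longrightarrow> \<bar>x u\<bar> \<le> 1"
  shows "(\<lambda>n. \<Sum>i<Suc n. x (grid s t (Suc n) (Suc i)) *
            (a (grid s t (Suc n) (Suc i)) - a (grid s t (Suc n) i)))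
          \<longlonglongrightarrow> (\<integral>u. x u * indicator {s<..t} u \<partial>\<mu>)"
    and "integrable \<mu> (\<lambda>u. x u * indicator {s<..t} u)"
proof -
  define \<phi> where "\<phi> n v = (\<Sum>i<Suc n. x (grid s t (Suc n) (Suc i)) *
      indicator {grid s t (Suc n) i<..grid s t (Suc n) (Suc i)} v)" for n v
  have sets[measurable_cong]: "sets \<mu> = sets borel" by (simp add: \<mu>_def)
  have cell: "\<exists>y. \<phi> n v = x y \<and> v \<le> y \<and> y \<le> v + (t - s) / real (Suc n)" if v: "s < v" "v \<le> t" for n v
  proof -
    obtain i where i: "i < Suc n" "grid s t (Suc n) i < v" "v \<le> grid s t (Suc n) (Suc i)"
      using grid_cell[OF v] by blast
    have "indicator {grid s t (Suc n) j<..grid s t (Suc n) (Suc j)} v = (if j = i then 1 else 0 :: real)" for j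
    proof (cases j i rule: linorder_cases)
      case less
      then have "grid s t (Suc n) (Suc j) \<le> grid s t (Suc n) i" using st by (intro grid_mono) auto
      then show ?thesis using i less by simp
    next
      case greater
      then have "grid s t (Suc n) (Suc i) \<le> grid s t (Suc n) j" using st by (intro grid_mono) auto
      then show ?thesis using i greater by simp
    qed (use i in simp)
    then have "\<phi> n v = x (grid s t (Suc n) (Suc i))"
      using i(1) by (simp add: \<phi>_def if_distrib[of "\<lambda>b. _ * b"] sum.delta del: sum.lessThan_Suc cong: if_cong)
    then show ?thesis using i grid_Suc[of s t "Suc n" i] by (intro exI[of _ "grid s t (Suc n) (Suc i)"]) auto
  qed
  have out: "\<phi> n v = 0" if v: "\<not> (s < v \<and> v \<le> t)" for n v
    unfolding \<phi>_def
  proof (intro sum.neutral ballI)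
    fix i assume "i \<in> {..<Suc n}"
    then show "x (grid s t (Suc n) (Suc i)) * indicator {grid s t (Suc n) i<..grid s t (Suc n) (Suc i)} v = 0"
      using v grid_bounds(1)[OF st(2), of i "Suc n"] grid_bounds(2)[OF st(2), of "Suc i" "Suc n"]
      by (auto simp: indicator_def)
  qed
  have lim: "(\<lambda>n. \<phi> n v) \<longlonglongrightarrow> x v * indicator {s<..t} v" for v
  proof (cases "s < v \<and> v \<le> t")
    case True
    then obtain y where y: "\<And>n. \<phi> n v = x (y n)" "\<And>n. v \<le> y n" "\<And>n. y n \<le> v + (t - s) / real (Suc n)"
      using cell[of v] by metis
    have "(\<lambda>n. v + (t - s) / real (Suc n)) \<longlonglongrightarrow> v + 0"
      by (intro tendsto_intros tendsto_mesh)
    then have "y \<longlonglongrightarrow> v"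
      by (intro tendsto_sandwich[of "\<lambda>_. v" y _ "\<lambda>n. v + (t - s) / real (Suc n)"]) (use y in auto)
    moreover have "continuous (at v within {v..}) x"
      using x(1)[of v] st True by (simp add: continuous_within at_within_Ici_at_right)
    ultimately have "(\<lambda>n. x (y n)) \<longlonglongrightarrow> x v"
      using y(2) by (intro continuous_within_tendsto_compose'[of v "{v..}" x]) auto
    then show ?thesis using True y(1) by simp
  qed (simp add: out)
  have bd: "\<bar>\<phi> n v\<bar> \<le> indicator {s<..t} v" for n v
  proof (cases "s < v \<and> v \<le> t")
    case True
    then obtain y where "\<phi> n v = x y" "v \<le> y" using cell[of v n] by blast
    then show ?thesis using True x(2)[of y] st by simp
  qed (simp add: out)
  have fin: "emeasure \<mu> {u<..v} < \<infinity>" if "0 \<le> u" "u \<le> v" for u v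
    using Stieltjes_Ioc(1)[OF a that] by (simp add: \<mu>_def)
  have m[measurable]: "\<phi> n \<in> borel_measurable \<mu>" for n unfolding \<phi>_def by measurable
  have lm[measurable]: "(\<lambda>v. x v * indicator {s<..t} v) \<in> borel_measurable \<mu>"
    by (rule borel_measurable_LIMSEQ_real[OF lim m])
  have w: "integrable \<mu> (indicator {s<..t} :: real \<Rightarrow> real)"
    using fin[OF st] by (auto simp: integrable_indicator_iff sets)
  show "integrable \<mu> (\<lambda>u. x u * indicator {s<..t} u)"
    by (rule Bochner_Integration.integrable_bound[OF w lm]) (use x(2) st in \<open>auto simp: indicator_def\<close>)
  have "(\<lambda>n. integral\<^sup>L \<mu> (\<phi> n)) \<longlonglongrightarrow> (\<integral>u. x u * indicator {s<..t} u \<partial>\<mu>)"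
    by (rule integral_dominated_convergence[OF lm m w]) (use lim bd in auto)
  moreover have "integral\<^sup>L \<mu> (\<phi> n) = (\<Sum>i<Suc n. x (grid s t (Suc n) (Suc i)) *
            (a (grid s t (Suc n) (Suc i)) - a (grid s t (Suc n) i)))" for n
  proof -
    have b: "0 \<le> grid s t (Suc n) i" "grid s t (Suc n) i \<le> grid s t (Suc n) (Suc i)" if "i < Suc n" for i
      using grid_bounds(1)[OF st(2), of i "Suc n"] grid_mono[OF st(2), of i "Suc i"] st that by auto
    have "integral\<^sup>L \<mu> (\<phi> n) = (\<Sum>i<Suc n. \<integral>v. x (grid s t (Suc n) (Suc i)) *
        indicator {grid s t (Suc n) i<..grid s t (Suc n) (Suc i)} v \<partial>\<mu>)"
      unfolding \<phi>_def by (intro Bochner_Integration.integral_sum)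
        (use fin b in \<open>auto simp: integrable_indicator_iff sets intro!: integrable_mult_right\<close>)
    also have "\<dots> = (\<Sum>i<Suc n. x (grid s t (Suc n) (Suc i)) *
            (a (grid s t (Suc n) (Suc i)) - a (grid s t (Suc n) i)))"
      using Stieltjes_Ioc(2)[OF a b] by (intro sum.cong) (auto simp: \<mu>_def)
    finally show ?thesis .
  qed
  ultimately show "(\<lambda>n. \<Sum>i<Suc n. x (grid s t (Suc n) (Suc i)) *
            (a (grid s t (Suc n) (Suc i)) - a (grid s t (Suc n) i)))
          \<longlonglongrightarrow> (\<integral>u. x u * indicator {s<..t} u \<partial>\<mu>)" by simp
qed

text \<open>At most one term is nonzero, namely the increment with which \<open>a\<close> leaves the
  value \<open>a 0\<close>; by monotonicity it never returns.\<close>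

lemma sum_first_increment_le:
  fixes a :: "nat \<Rightarrow> real"
  assumes "\<And>i. i < n \<Longrightarrow> a i \<le> a (Suc i)" "\<And>i. i < n \<Longrightarrow> a (Suc i) - a i \<le> e" "0 \<le> e"
  shows "(\<Sum>i<n. if a i = a 0 then a (Suc i) - a i else 0) \<le> e"
proof -
  have "(\<Sum>i<m. if a i = a 0 then a (Suc i) - a i else 0) \<le> e \<and> a 0 \<le> a m \<and>
      (a m = a 0 \<longrightarrow> (\<Sum>i<m. if a i = a 0 then a (Suc i) - a i else 0) = 0)" if "m \<le> n" for m
    using that
  proof (induction m)
    case (Suc m)
    then show ?case using assms(1)[of m] assms(2)[of m] by auto
  qed (use assms in simp)
  then show ?thesis by blast
qed

text \<open>\<open>S n\<close> is the amount by which \<open>a\<close> exceeds \<open>a s\<close> at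
  the first grid point where it differs from it. This overshoot is at most the oscillation of
  \<open>a\<close> over one cell, which uniform continuity makes small. The two bounds serve
  dominated convergence.\<close>

lemma first_increment_tendsto_0:
  fixes a :: "real \<Rightarrow> real"
  assumes mono: "mono_on {s..t} a" and cont: "continuous_on {s..t} a" and st: "s \<le> t"
  defines "S \<equiv> \<lambda>n. \<Sum>i<Suc n. if a (grid s t (Suc n) i) = a s
      then a (grid s t (Suc n) (Suc i)) - a (grid s t (Suc n) i) else 0"
  shows "S \<longlonglongrightarrow> 0" "\<And>n. 0 \<le> S n" "\<And>n. S n \<le> a t - a s"
proof -
  have inc: "a (grid s t (Suc n) i) \<le> a (grid s t (Suc n) (Suc i))" if "i < Suc n" for n i
    using grid_bounds[OF st, of i "Suc n"] grid_bounds[OF st, of "Suc i" "Suc n"]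
      grid_mono[OF st, of i "Suc i"] that by (intro mono_onD[OF mono]) auto
  show nn: "0 \<le> S n" for n
    unfolding S_def by (intro sum_nonneg) (use inc in fastforce)
  have "S n \<le> (\<Sum>i<Suc n. a (grid s t (Suc n) (Suc i)) - a (grid s t (Suc n) i))" for n
    unfolding S_def by (intro sum_mono) (use inc in fastforce)
  moreover have "(\<Sum>i<Suc n. a (grid s t (Suc n) (Suc i)) - a (grid s t (Suc n) i)) = a t - a s" for n
    by (subst sum_lessThan_telescope) simp
  ultimately show "S n \<le> a t - a s" for n by (simp del: sum.lessThan_Suc)
  show "S \<longlonglongrightarrow> 0"
  proof (rule LIMSEQ_I)
    fix e :: real assume e: "0 < e"
    have "uniformly_continuous_on {s..t} a"
      by (intro compact_uniformly_continuous cont) simp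
    then obtain d where d: "0 < d"
      "\<And>u v. u \<in> {s..t} \<Longrightarrow> v \<in> {s..t} \<Longrightarrow> dist u v < d \<Longrightarrow> dist (a u) (a v) < e / 2"
      using e unfolding uniformly_continuous_on_def by (metis half_gt_zero)
    obtain N where N: "\<And>n. n \<ge> N \<Longrightarrow> (t - s) / real (Suc n) < d"
      using order_tendstoD(2)[OF tendsto_mesh d(1), of "t - s"] by (auto simp: eventually_sequentially)
    have "norm (S n - 0) < e" if "n \<ge> N" for n
    proof -
      have "S n \<le> e / 2"
        unfolding S_def
      proof (rule sum_first_increment_le[of "Suc n" "\<lambda>i. a (grid s t (Suc n) i)", simplified grid_0])
        fix i assume i: "i < Suc n"
        then show "a (grid s t (Suc n) i) \<le> a (grid s t (Suc n) (Suc i))" by (rule inc)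
        have "dist (a (grid s t (Suc n) (Suc i))) (a (grid s t (Suc n) i)) < e / 2"
          using grid_bounds[OF st, of i "Suc n"] grid_bounds[OF st, of "Suc i" "Suc n"] i N[OF that] st
          by (intro d(2)) (auto simp: grid_Suc dist_real_def)
        then show "a (grid s t (Suc n) (Suc i)) - a (grid s t (Suc n) i) \<le> e / 2"
          unfolding dist_real_def by linarith
      qed (use e in simp)
      then show ?thesis using nn[of n] e by simp
    qed
    then show "\<exists>N. \<forall>n\<ge>N. norm (S n - 0) < e" by blast
  qed
qed

lemma Stieltjes_carried_imp_constant:
  fixes a x :: "real \<Rightarrow> real"
  assumes a: "mono_on {0..} a" "continuous_on {0..} a" and st: "0 \<le> s" "s \<le> t"
    and ae: "AE u in interval_measure (\<lambda>u. a (max 0 u)). u \<notin> {s<..t}"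
  shows "a t = a s"
proof -
  have "emeasure (interval_measure (\<lambda>u. a (max 0 u))) {s<..t} = 0"
    using ae by (subst (asm) AE_iff_measurable[of "{s<..t}"]) auto
  moreover have "a s \<le> a t" using st by (intro mono_onD[OF a(1)]) auto
  ultimately show ?thesis using Stieltjes_Ioc(1)[OF a st] by (simp add: ennreal_eq_0_iff)
qed

section \<open>The sigma-algebra of the natural enlargement\<close>

lemma property_NP_filtered_prob_space: "property_NP P F \<Longrightarrow> filtered_prob_space P F"
  by (auto simp: property_NP_def natural_enlargement_def filtered_extension_def)

text \<open>The restriction of \<open>P\<close> to the \<open>\<sigma>\<close>-algebra generated by all \<open>F t\<close> still satisfies the natural
  conditions, so minimality of the natural enlargement shows that it is all of \<open>P\<close>.\<close>

lemma property_NP_sets_eq: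
  assumes "property_NP P F"
  shows "sets P = sigma_sets (space P) (\<Union>t\<in>{0..}. sets (F t))"
proof -
  obtain P0 F0 where P: "property_P P0 F0" and e: "natural_enlargement P0 F0 P F"
    using assms unfolding property_NP_def by blast
  have ext: "filtered_extension P0 F0 P F" and nat: "natural_conditions P F"
    using e by (auto simp: natural_enlargement_def)
  have fp: "prob_space P" "filtered_space P F"
    using ext by (auto simp: filtered_extension_def filtered_prob_space_def)
  have subP: "subalgebra P (F t)" if "0 \<le> t" for t
    using fp(2) that by (auto simp: filtered_space_def)
  define S where "S = sigma (space P) (\<Union>t\<in>{0..}. sets (F t))"
  have pow: "(\<Union>t\<in>{0..}. sets (F t)) \<subseteq> Pow (space P)"
    using subP by (fastforce simp: subalgebra_def dest: sets.sets_into_space)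
  have setsS: "sets S = sigma_sets (space P) (\<Union>t\<in>{0..}. sets (F t))"
    and spaceS: "space S = space P"
    using pow by (simp_all add: S_def)
  have FS: "sets (F t) \<subseteq> sets S" if "0 \<le> t" for t
    using that unfolding setsS by (auto intro: sigma_sets.Basic)
  have SP: "sets S \<subseteq> sets P"
    unfolding setsS using subP by (intro sets.sigma_sets_subset) (auto simp: subalgebra_def)
  have sub: "subalgebra P S" using SP spaceS by (simp add: subalgebra_def)
  define P' where "P' = restr_to_subalg P S"
  have P': "sets P' = sets S" "space P' = space P" "\<And>B. B \<in> sets S \<Longrightarrow> emeasure P' B = emeasure P B"
    unfolding P'_def using sub
    by (simp_all add: sets_restr_to_subalg space_restr_to_subalg emeasure_restr_to_subalg)
  have fsp: "filtered_prob_space P' F"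
    using fp FS P' prob_space_restr_to_subalg[OF sub fp(1)]
    unfolding filtered_prob_space_def filtered_space_def P'_def[symmetric]
    by (auto simp: subalgebra_def)
  \<comment> \<open>The natural conditions involve only the filtration and the values of the
    probability on its events, and \<open>P'\<close> shares both with \<open>P\<close>.\<close>
  have "natural_conditions P' F"
    using nat fsp FS P'(3) unfolding natural_conditions_def by (metis subsetD)
  moreover have "filtered_extension P0 F0 P' F"
  proof -
    have "sets P0 \<subseteq> sets S"
    proof -
      have "sets P0 = sigma_sets (space P0) (\<Union>t\<in>{0..}. sets (F0 t))"
        using P by (simp add: property_P_def)
      also have "\<dots> \<subseteq> sets S"
      proof -
        have "space P0 = space S" "\<And>t. 0 \<le> t \<Longrightarrow> sets (F0 t) \<subseteq> sets (F t)"
          using ext spaceS by (auto simp: filtered_extension_def)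
        then show ?thesis
          using FS by (simp only:) (intro sets.sigma_sets_subset, fastforce)
      qed
      finally show ?thesis .
    qed
    then show ?thesis using ext fsp P' unfolding filtered_extension_def by (auto simp: subset_iff)
  qed
  ultimately have "filtered_extension P F P' F"
    using e unfolding natural_enlargement_def by blast
  then have "sets P \<subseteq> sets S" using P' by (simp add: filtered_extension_def)
  then show ?thesis using SP setsS by auto
qed

section \<open>Filtered probability spaces\<close>

locale filtered_probability = prob_space P for P :: "'a measure" +
  fixes F :: "real \<Rightarrow> 'a measure"
  assumes filtered: "filtered_space P F"
begin

lemma subalg: "0 \<le> t \<Longrightarrow> subalgebra P (F t)"
  using filtered by (auto simp: filtered_space_def)

lemma space_F: "0 \<le> t \<Longrightarrow> space (F t) = space P"
  using subalg by (auto simp: subalgebra_def)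

lemma sets_F: "0 \<le> t \<Longrightarrow> B \<in> sets (F t) \<Longrightarrow> B \<in> sets P"
  using subalg by (auto simp: subalgebra_def)

lemma sets_F_mono: "0 \<le> s \<Longrightarrow> s \<le> t \<Longrightarrow> sets (F s) \<subseteq> sets (F t)"
  using filtered by (auto simp: filtered_space_def subalgebra_def)

lemma measurable_F_mono: "0 \<le> s \<Longrightarrow> s \<le> t \<Longrightarrow> f \<in> measurable (F s) M \<Longrightarrow> f \<in> measurable (F t) M"
  by (rule measurable_from_subalg) (use filtered in \<open>auto simp: filtered_space_def\<close>)

lemma measurable_F: "0 \<le> s \<Longrightarrow> f \<in> measurable (F s) M \<Longrightarrow> f \<in> measurable P M"
  using subalg measurable_from_subalg by blast

lemma set_integral_cond_exp:
  assumes "0 \<le> s" "E \<in> sets (F s)" "integrable P f" "AE x in P. real_cond_exp P (F s) f x = g x"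
    "g \<in> borel_measurable (F s)"
  shows "(\<integral>x\<in>E. f x \<partial>P) = (\<integral>x\<in>E. g x \<partial>P)"
proof -
  interpret finite_measure_subalgebra P "F s"
    by unfold_locales (rule subalg[OF assms(1)])
  have "(\<integral>x\<in>E. f x \<partial>P) = (\<integral>x\<in>E. real_cond_exp P (F s) f x \<partial>P)"
    using assms by (intro real_cond_exp_intA)
  also have "\<dots> = (\<integral>x\<in>E. g x \<partial>P)"
    using assms sets_F measurable_F[OF assms(1)]
    by (intro set_lebesgue_integral_cong_AE) (auto elim: eventually_mono)
  finally show ?thesis .
qed

text \<open>The starting time \<open>s\<close> is free because the densities of \<open>Q\<close>
  restricted to \<open>{g \<le> s}\<close> are available only on \<open>F t\<close> with
  \<open>t \<ge> s\<close>.\<close>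

lemma generated_by_sequence:
  assumes gen: "sets P = sigma_sets (space P) (\<Union>t\<in>{0..}. sets (F t))" and s: "0 \<le> s"
  shows "sets P = sigma_sets (space P) (\<Union>n. sets (F (s + real n)))"
proof
  have "(\<Union>t\<in>{0..}. sets (F t)) \<subseteq> (\<Union>n. sets (F (s + real n)))"
  proof (intro UN_least)
    fix t :: real assume t: "t \<in> {0..}"
    obtain n where "t \<le> real n" using real_arch_simple by blast
    then have "sets (F t) \<subseteq> sets (F (s + real n))" using s t by (intro sets_F_mono) auto
    then show "sets (F t) \<subseteq> (\<Union>n. sets (F (s + real n)))" by blast
  qed
  then show "sets P \<subseteq> sigma_sets (space P) (\<Union>n. sets (F (s + real n)))"
    unfolding gen by (rule sigma_sets_subseteq)
  show "sigma_sets (space P) (\<Union>n. sets (F (s + real n))) \<subseteq> sets P"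
    using s sets_F[of "s + real _"] by (intro sets.sigma_sets_subset) fastforce
qed

end

section \<open>Processes of class (\<open>\<Sigma>\<close>) stopped when \<open>A\<close> starts to
  increase\<close>

locale class_Sigma_process = filtered_probability +
  fixes X N A :: "real \<Rightarrow> 'a \<Rightarrow> real"
  assumes class_Sigma: "class_Sigma P F X N A"
begin

lemma X_meas_F: "0 \<le> t \<Longrightarrow> X t \<in> borel_measurable (F t)"
  and A_meas_F: "0 \<le> t \<Longrightarrow> A t \<in> borel_measurable (F t)"
  and N_meas_F: "0 \<le> t \<Longrightarrow> N t \<in> borel_measurable (F t)"
  and X_int: "0 \<le> t \<Longrightarrow> integrable P (X t)"
  and N_int: "0 \<le> t \<Longrightarrow> integrable P (N t)"
  and X_nonneg: "0 \<le> t \<Longrightarrow> x \<in> space P \<Longrightarrow> 0 \<le> X t x"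
  and X_eq: "0 \<le> t \<Longrightarrow> x \<in> space P \<Longrightarrow> X t x = N t x + A t x"
  and A_mono: "x \<in> space P \<Longrightarrow> mono_on {0..} (\<lambda>t. A t x)"
  and A_cont: "x \<in> space P \<Longrightarrow> continuous_on {0..} (\<lambda>t. A t x)"
  and A_carried: "AE x in P. AE t in interval_measure (\<lambda>s. A (max 0 s) x). 0 \<le> t \<longrightarrow> X t x = 0"
  using class_Sigma unfolding class_Sigma_def submartingale_def martingale_def adapted_def nonneg_on_def
  by auto

lemma A_int: "0 \<le> t \<Longrightarrow> integrable P (A t)"
  using Bochner_Integration.integrable_diff[OF X_int N_int, of t t] X_eq
  by (subst Bochner_Integration.integrable_cong[OF refl, of P "A t" "\<lambda>x. X t x - N t x"]) auto

lemma A_le: "x \<in> space P \<Longrightarrow> 0 \<le> s \<Longrightarrow> s \<le> t \<Longrightarrow> A s x \<le> A t x"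
  using mono_onD[OF A_mono] by auto

lemma A_nonneg: "x \<in> space P \<Longrightarrow> 0 \<le> t \<Longrightarrow> 0 \<le> A t x"
  using A_le[of x 0 t] class_Sigma by (auto simp: class_Sigma_def)

lemma X_right_continuous:
  assumes "x \<in> space P" "0 \<le> t"
  shows "((\<lambda>s. X s x) \<longlongrightarrow> X t x) (at_right t)"
proof -
  have "((\<lambda>s. N s x) \<longlongrightarrow> N t x) (at_right t)"
    using class_Sigma assms by (auto simp: class_Sigma_def cadlag_on_def)
  moreover have "((\<lambda>s. A s x) \<longlongrightarrow> A t x) (at_right t)"
    using A_cont[OF assms(1)] assms(2)
    by (auto simp: continuous_on_def intro: tendsto_within_subset)
  ultimately have "((\<lambda>s. N s x + A s x) \<longlongrightarrow> X t x) (at_right t)"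
    using assms by (simp add: X_eq tendsto_add)
  moreover have "\<forall>\<^sub>F s in at_right t. N s x + A s x = X s x"
    using assms X_eq by (auto simp: eventually_at_filter)
  ultimately show ?thesis by (rule Lim_transform_eventually)
qed

lemma A_eq_set: "0 \<le> s \<Longrightarrow> s \<le> t \<Longrightarrow> {x \<in> space P. A t x = A s x} \<in> sets (F t)"
  using borel_measurable_eq[OF A_meas_F[of t] measurable_F_mono[OF _ _ A_meas_F, of s t]] space_F[of t]
  by simp

text \<open>Let \<open>\<tau>\<close> be the first time at which \<open>A\<close> exceeds \<open>A s\<close>.  The left-hand side is at most the
  expectation of \<open>X\<close> at time \<open>min \<tau> t\<close>, which is that of \<open>X s\<close>.  The grid replaces optional stopping.\<close>

lemma expectation_until_increase_le:
  assumes st: "0 \<le> s" "s \<le> t"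
  shows "(\<integral>x. X t x * indicator {x \<in> space P. A t x = A s x} x \<partial>P) \<le> (\<integral>x. X s x \<partial>P)"
proof -
  define I where "I n i = {x \<in> space P. A (grid s t (Suc n) i) x = A s x}" for n i
  define S where "S n x = (\<Sum>i<Suc n. if A (grid s t (Suc n) i) x = A s x
      then A (grid s t (Suc n) (Suc i)) x - A (grid s t (Suc n) i) x else 0)" for n x
  have g: "s \<le> grid s t (Suc n) i" "0 \<le> grid s t (Suc n) i" for n i
    using grid_mono[OF st(2), of 0 i "Suc n"] st(1) by auto
  have gS: "grid s t (Suc n) i \<le> grid s t (Suc n) (Suc i)" for n i
    using grid_mono[OF st(2)] by simp
  have IF: "I n i \<in> sets (F (grid s t (Suc n) i))" for n i
    unfolding I_def by (intro A_eq_set st g)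
  have IP[measurable]: "I n i \<in> sets P" for n i
    using sets_F[OF g(2) IF] .
  have int: "integrable P (\<lambda>x. f x * indicator (I n i) x)" if "integrable P f" for f :: "'a \<Rightarrow> real" and n i
    using that by (intro integrable_real_mult_indicator) auto
  have Ni: "(\<integral>x. N (grid s t (Suc n) (Suc i)) x * indicator (I n i) x \<partial>P)
      = (\<integral>x. N (grid s t (Suc n) i) x * indicator (I n i) x \<partial>P)" for n i
  proof -
    have "AE x in P. real_cond_exp P (F (grid s t (Suc n) i)) (N (grid s t (Suc n) (Suc i))) x
        = N (grid s t (Suc n) i) x"
      using class_Sigma g gS by (auto simp: class_Sigma_def martingale_def)
    then show ?thesis
      using set_integral_cond_exp[OF g(2) IF N_int[OF g(2)] _ N_meas_F[OF g(2)]]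
      by (simp add: set_lebesgue_integral_def mult.commute)
  qed
  \<comment> \<open>This is optional stopping in discrete time. On \<open>I n j\<close>, an event
    known at the left end of the cell, the increment of \<open>N\<close> has integral 0, so
    \<open>X\<close> grows in mean exactly as \<open>A\<close> does. Shrinking \<open>I n j\<close>
    to \<open>I n (Suc j)\<close> only loses mass, as \<open>X\<close> is nonnegative.\<close>
  have step: "(\<integral>x. X (grid s t (Suc n) j) x * indicator (I n j) x \<partial>P) \<le> (\<integral>x. X s x \<partial>P) +
      (\<Sum>i<j. \<integral>x. (A (grid s t (Suc n) (Suc i)) x - A (grid s t (Suc n) i) x) * indicator (I n i) x \<partial>P)"
    for n j
  proof (induction j)
    case 0
    then show ?case by (auto simp: I_def intro!: eq_refl Bochner_Integration.integral_cong)
  next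
    case (Suc j)
    let ?u = "grid s t (Suc n) j" and ?v = "grid s t (Suc n) (Suc j)"
    have sub: "I n (Suc j) \<subseteq> I n j"
    proof
      fix x assume "x \<in> I n (Suc j)"
      then have x: "x \<in> space P" "A ?v x = A s x" by (auto simp: I_def)
      then show "x \<in> I n j"
        using A_le[OF x(1) st(1) g(1)[of n j]] A_le[OF x(1) g(2) gS, of n j] by (auto simp: I_def)
    qed
    have "(\<integral>x. X ?v x * indicator (I n (Suc j)) x \<partial>P) \<le> (\<integral>x. X ?v x * indicator (I n j) x \<partial>P)"
      using sub X_nonneg[OF g(2)] by (intro integral_mono int X_int g) (auto simp: indicator_def)
    also have "\<dots> = (\<integral>x. N ?v x * indicator (I n j) x + A ?v x * indicator (I n j) x \<partial>P)"
      using X_eq[OF g(2)] by (intro Bochner_Integration.integral_cong) (auto simp: distrib_right)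
    also have "\<dots> = (\<integral>x. N ?u x * indicator (I n j) x \<partial>P) + (\<integral>x. A ?v x * indicator (I n j) x \<partial>P)"
      by (subst Bochner_Integration.integral_add) (auto intro!: int N_int A_int g simp: Ni)
    also have "\<dots> = (\<integral>x. N ?u x * indicator (I n j) x + A ?v x * indicator (I n j) x \<partial>P)"
      by (subst Bochner_Integration.integral_add) (auto intro!: int N_int A_int g)
    also have "\<dots> = (\<integral>x. X ?u x * indicator (I n j) x + (A ?v x - A ?u x) * indicator (I n j) x \<partial>P)"
      using X_eq[OF g(2)] by (intro Bochner_Integration.integral_cong) (auto simp: algebra_simps)
    also have "\<dots> = (\<integral>x. X ?u x * indicator (I n j) x \<partial>P)
        + (\<integral>x. (A ?v x - A ?u x) * indicator (I n j) x \<partial>P)"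
      by (subst Bochner_Integration.integral_add)
        (auto intro!: int X_int A_int g Bochner_Integration.integrable_diff simp del: left_diff_distrib)
    finally show ?case using Suc.IH by simp
  qed
  have S_int: "(\<Sum>i<Suc n. \<integral>x. (A (grid s t (Suc n) (Suc i)) x - A (grid s t (Suc n) i) x) * indicator (I n i) x \<partial>P)
      = (\<integral>x. S n x \<partial>P)" for n
  proof -
    have "(\<integral>x. S n x \<partial>P) = (\<integral>x. (\<Sum>i<Suc n. (A (grid s t (Suc n) (Suc i)) x - A (grid s t (Suc n) i) x) *
        indicator (I n i) x) \<partial>P)"
      unfolding S_def
      by (intro Bochner_Integration.integral_cong sum.cong) (auto simp: I_def indicator_def)
    also have "\<dots> = (\<Sum>i<Suc n. \<integral>x. (A (grid s t (Suc n) (Suc i)) x - A (grid s t (Suc n) i) x) *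
        indicator (I n i) x \<partial>P)"
      by (intro Bochner_Integration.integral_sum int Bochner_Integration.integrable_diff A_int g)
    finally show ?thesis by (rule sym)
  qed
  have le: "(\<integral>x. X t x * indicator {x \<in> space P. A t x = A s x} x \<partial>P) \<le> (\<integral>x. X s x \<partial>P) + (\<integral>x. S n x \<partial>P)" for n
    using step[of n "Suc n"] unfolding S_int by (simp add: I_def)
  have S: "(\<lambda>n. S n x) \<longlonglongrightarrow> 0" "\<And>n. 0 \<le> S n x" "\<And>n. S n x \<le> A t x - A s x" if "x \<in> space P" for x
    using first_increment_tendsto_0[of s t "\<lambda>t. A t x", OF mono_on_subset[OF A_mono[OF that]]
      continuous_on_subset[OF A_cont[OF that]] st(2)] st(1)
    unfolding S_def by auto
  \<comment> \<open>The error of the grid is the overshoot of \<open>A\<close> past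
    \<open>A s\<close>. It tends to 0 pathwise by continuity, and the integrable variable
    \<open>A t\<close> dominates it.\<close>
  have "(\<lambda>n. \<integral>x. S n x \<partial>P) \<longlonglongrightarrow> (\<integral>x. 0 \<partial>P)"
  proof (rule integral_dominated_convergence[where w = "A t"])
    show "S n \<in> borel_measurable P" for n
    proof -
      have [measurable]: "A (grid s t (Suc n) i) \<in> borel_measurable P" "A s \<in> borel_measurable P" for i
        using measurable_F[OF _ A_meas_F] g st by auto
      show ?thesis unfolding S_def by measurable
    qed
    show "AE x in P. norm (S n x) \<le> A t x" for n
    proof (rule AE_I2)
      fix x assume x: "x \<in> space P"
      show "norm (S n x) \<le> A t x" using S(2,3)[OF x, of n] A_nonneg[OF x st(1)] by simp
    qed
  qed (use S A_int st in auto)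
  then have "(\<lambda>n. (\<integral>x. X s x \<partial>P) + (\<integral>x. S n x \<partial>P)) \<longlonglongrightarrow> (\<integral>x. X s x \<partial>P) + 0"
    by (intro tendsto_intros) simp
  then show ?thesis using le by (intro LIMSEQ_le_const) auto
qed

end

section \<open>The measure \<open>Q\<close> and the last zero of \<open>X\<close>\<close>

locale Sigma_measure_process = class_Sigma_process +
  fixes Q :: "'a measure"
  assumes Sigma_measure: "Sigma_measure P F X Q"
begin

text \<open>The event \<open>{g \<le> t}\<close>: after time \<open>t\<close> the process has no
  zero, so \<open>dA\<close> is expected to be inactive there. The event looks into the future and
  need not belong to \<open>F t\<close>.\<close>

definition inactive :: "real \<Rightarrow> 'a set" where
  "inactive t = {x \<in> space P. last_zero X x \<le> ennreal t}"

lemma sets_Q: "sets Q = sets P"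
  and sigma_finite_Q: "sigma_finite_measure Q"
  and last_zero_finite: "{x \<in> space P. last_zero X x = \<infinity>} \<in> null_sets Q"
  and inactive_sets: "0 \<le> t \<Longrightarrow> inactive t \<in> sets P"
  using Sigma_measure by (auto simp: Sigma_measure_def inactive_def)

lemma space_Q: "space Q = space P"
  using sets_Q by (rule sets_eq_imp_space_eq)

lemma inactive_mono: "s \<le> t \<Longrightarrow> inactive s \<subseteq> inactive t"
  by (auto simp: inactive_def intro: order_trans ennreal_leI)

lemma UN_inactive: "(\<Union>n. inactive (real n)) = space P - {x \<in> space P. last_zero X x = \<infinity>}"
proof -
  have "\<exists>n. last_zero X x \<le> ennreal (real n)" if "last_zero X x \<noteq> \<infinity>" for x
  proof -
    obtain r where "last_zero X x = ennreal r"
      using \<open>last_zero X x \<noteq> \<infinity>\<close> by (cases "last_zero X x") auto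
    then show ?thesis using real_arch_simple[of r] by (auto intro: ennreal_leI)
  qed
  then show ?thesis by (auto simp: inactive_def top_unique)
qed

lemma X_pos_inactive:
  assumes "x \<in> inactive s" "0 \<le> s" "s < u"
  shows "0 < X u x"
proof -
  have "X u x \<noteq> 0"
  proof
    assume "X u x = 0"
    then have "ennreal u \<le> last_zero X x"
      using assms unfolding last_zero_def by (intro SUP_upper) auto
    then have "ennreal u \<le> ennreal s" using assms(1) by (auto simp: inactive_def)
    then show False using assms by (simp add: ennreal_le_iff)
  qed
  then show ?thesis using X_nonneg[of u x] assms by (simp add: inactive_def)
qed

lemma emeasure_Q_inactive:
  assumes "0 \<le> t" "E \<in> sets (F t)"
  shows "emeasure Q (E \<inter> inactive t) = ennreal (\<integral>x. X t x * indicator E x \<partial>P)"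
proof -
  have "bounded_measurable (F t) (indicator E)"
    using assms by (auto simp: bounded_measurable_def intro!: exI[of _ 1] simp: indicator_def)
  then have "has_bochner_integral Q (\<lambda>x. indicator E x * indicator (inactive t) x :: real)
      (\<integral>x. indicator E x * X t x \<partial>P)"
    using Sigma_measure assms(1) unfolding Sigma_measure_def inactive_def by blast
  then have h: "has_bochner_integral Q (indicator (E \<inter> inactive t)) (\<integral>x. indicator E x * X t x \<partial>P)"
    by (simp add: indicator_inter_arith[symmetric])
  have EQ: "E \<inter> inactive t \<in> sets Q"
    using sets_F[OF assms] inactive_sets[OF assms(1)] sets_Q by auto
  have "integrable Q (indicator (E \<inter> inactive t) :: 'a \<Rightarrow> real)"
    using h by (rule integrable.intros)
  then have fin: "emeasure Q (E \<inter> inactive t) < \<infinity>"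
    using EQ sets.sets_into_space[OF EQ] by (simp add: integrable_indicator_iff Int_absorb2)
  have "measure Q (E \<inter> inactive t) = (\<integral>x. indicator E x * X t x \<partial>P)"
    using has_bochner_integral_integral_eq[OF h] sets.sets_into_space[OF EQ]
    by (simp add: Int_absorb2)
  then show ?thesis using fin by (simp add: emeasure_eq_ennreal_measure mult.commute less_top)
qed

text \<open>This is the channel through which null sets pass from \<open>P\<close> to
  \<open>Q\<close>. The restriction to \<open>F t\<close> is essential: when \<open>A\<close> tends
  to infinity \<open>P\<close>-a.s., the event \<open>{g < \<infinity>}\<close> is
  \<open>P\<close>-null and yet carries all of \<open>Q\<close>.\<close>

lemma null_set_inactive:
  assumes "0 \<le> t" "E \<in> sets (F t)" "emeasure P E = 0"
  shows "emeasure Q (E \<inter> inactive t) = 0"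
proof -
  have "E \<in> null_sets P" using assms sets_F by auto
  then have "AE x in P. x \<notin> E" by (rule AE_not_in)
  then have "(\<integral>x. X t x * indicator E x \<partial>P) = (\<integral>x. 0 \<partial>P)"
    using measurable_F[OF assms(1) X_meas_F[OF assms(1)]] sets_F[OF assms(1,2)]
    by (intro integral_cong_AE) (auto elim: eventually_mono)
  then show ?thesis using emeasure_Q_inactive[OF assms(1,2)] by simp
qed

text \<open>On \<open>{g \<le> s}\<close> there is no zero of \<open>X\<close> in \<open>(s, t]\<close>, so \<open>A\<close> should not charge this interval.  As
  \<open>P\<close>-null sets are not \<open>Q\<close>-null, the support property of \<open>dA\<close> has to be transferred from \<open>P\<close> to
  \<open>Q\<close> through an event of \<open>F t\<close>: this is the role of the Riemann sums.\<close>

lemma AE_Q_A_constant: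
  assumes st: "0 \<le> s" "s \<le> t"
  shows "AE x in Q. x \<in> inactive s \<longrightarrow> A t x = A s x"
proof -
  \<comment> \<open>Truncating \<open>X\<close> at 1 bounds the integrand, as the convergence of the
    Riemann sums requires, and does not change its zeros.\<close>
  define J where "J x = (\<integral>u. min 1 (X u x) * indicator {s<..t} u
      \<partial>interval_measure (\<lambda>u. A (max 0 u) x))" for x
  have x: "((\<lambda>u. min 1 (X u x)) \<longlongrightarrow> min 1 (X u x)) (at_right u)" "\<bar>min 1 (X u x)\<bar> \<le> 1"
    if "x \<in> space P" "0 \<le> u" for x u
    using X_right_continuous[OF that] X_nonneg[OF that(2,1)] by (auto intro: tendsto_intros)
  have RS: "(\<lambda>n. \<Sum>i<Suc n. min 1 (X (grid s t (Suc n) (Suc i)) x) *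
            (A (grid s t (Suc n) (Suc i)) x - A (grid s t (Suc n) i) x)) \<longlonglongrightarrow> J x"
    "integrable (interval_measure (\<lambda>u. A (max 0 u) x)) (\<lambda>u. min 1 (X u x) * indicator {s<..t} u)"
    if "x \<in> space P" for x
    using Riemann_Stieltjes_right_continuous[OF A_mono[OF that] A_cont[OF that] st,
        of "\<lambda>u. min 1 (X u x)"] x[OF that]
    unfolding J_def by blast+
  have meas: "J \<in> borel_measurable (F t)"
  proof (rule borel_measurable_LIMSEQ_real)
    show "(\<lambda>n. \<Sum>i<Suc n. min 1 (X (grid s t (Suc n) (Suc i)) x) *
            (A (grid s t (Suc n) (Suc i)) x - A (grid s t (Suc n) i) x)) \<longlonglongrightarrow> J x"
      if "x \<in> space (F t)" for x
      using RS(1)[of x] that space_F[of t] st by auto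
    fix n
    have g: "0 \<le> grid s t (Suc n) i \<and> grid s t (Suc n) i \<le> t" if "i \<le> Suc n" for i
      using grid_bounds[OF st(2) that] st(1) by auto
    have m: "X (grid s t (Suc n) i) \<in> borel_measurable (F t)" "A (grid s t (Suc n) i) \<in> borel_measurable (F t)"
      if "i \<le> Suc n" for i
      using g[OF that] measurable_F_mono[OF _ _ X_meas_F, of "grid s t (Suc n) i" t]
        measurable_F_mono[OF _ _ A_meas_F, of "grid s t (Suc n) i" t] by auto
    show "(\<lambda>x. \<Sum>i<Suc n. min 1 (X (grid s t (Suc n) (Suc i)) x) *
            (A (grid s t (Suc n) (Suc i)) x - A (grid s t (Suc n) i) x)) \<in> borel_measurable (F t)"
      using m by (intro borel_measurable_sum borel_measurable_times borel_measurable_diff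
        borel_measurable_min) auto
  qed
  \<comment> \<open>On \<open>E\<close> the measure \<open>dA\<close> charges \<open>{X > 0}\<close>
    within the interval \<open>(s, t]\<close>. This exceptional event lies in \<open>F t\<close>, so
    its \<open>P\<close>-nullity gives \<open>Q\<close>-nullity inside
    \<open>inactive t\<close>.\<close>
  define E where "E = {x \<in> space (F t). J x \<noteq> 0}"
  have E: "E \<in> sets (F t)" unfolding E_def using meas by measurable
  have "AE x in P. J x = 0"
    using A_carried
  proof eventually_elim
    case (elim x)
    show ?case
      unfolding J_def
    proof (rule integral_eq_zero_AE)
      show "AE u in interval_measure (\<lambda>u. A (max 0 u) x). min 1 (X u x) * indicator {s<..t} u = 0"
        using elim
      proof eventually_elim
        case (elim u)
        then show ?case using st(1) by (cases "u \<in> {s<..t}") simp_all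
      qed
    qed
  qed
  then have "emeasure P E = 0"
    using sets_F[OF _ E] st space_F[of t] by (subst (asm) AE_iff_measurable[of E]) (auto simp: E_def)
  then have E0: "emeasure Q (E \<inter> inactive t) = 0"
    using st E by (intro null_set_inactive) auto
  have "E \<inter> inactive t \<in> null_sets Q"
    using E0 sets_F[OF _ E] inactive_sets[of t] sets_Q st by (auto simp: null_sets_def)
  then have "AE x in Q. x \<notin> E \<inter> inactive t" by (rule AE_not_in)
  then show ?thesis
  proof (rule AE_mp, intro AE_I2 impI)
    fix x assume "x \<notin> E \<inter> inactive t" and xs: "x \<in> inactive s"
    then have xP: "x \<in> space P" and J: "J x = 0"
      using inactive_mono[OF st(2)] st space_F[of t] by (auto simp: E_def inactive_def)
    let ?\<mu> = "interval_measure (\<lambda>u. A (max 0 u) x)"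
    have i: "integrable ?\<mu> (\<lambda>u. min 1 (X u x) * indicator {s<..t} u)"
      by (rule RS(2)[OF xP])
    have "AE u in ?\<mu>. 0 \<le> min 1 (X u x) * indicator {s<..t} u"
      using X_nonneg[OF _ xP] st by (auto simp: indicator_def)
    then have "AE u in ?\<mu>. min 1 (X u x) * indicator {s<..t} u = 0"
      using J integral_nonneg_eq_0_iff_AE[OF i] by (simp add: J_def)
    \<comment> \<open>For a path with \<open>g \<le> s\<close> the truncated integrand is strictly
      positive on all of \<open>(s, t]\<close>, so it can vanish almost everywhere there only if the
      interval itself has no mass.\<close>
    then have "AE u in ?\<mu>. u \<notin> {s<..t}"
    proof eventually_elim
      case (elim u)
      then show ?case using X_pos_inactive[OF xs st(1), of u] by (cases "u \<in> {s<..t}") auto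
    qed
    then show "A t x = A s x"
      by (rule Stieltjes_carried_imp_constant[OF A_mono[OF xP] A_cont[OF xP] st])
  qed
qed

text \<open>If the last zero were at most \<open>n\<close>, then \<open>dA\<close>, being carried by
  the zeros of \<open>X\<close>, would have no mass after \<open>n\<close>, and \<open>A\<close>
  would stay at its value at time \<open>n\<close>.\<close>

lemma AE_P_last_zero_infinite:
  assumes "AE x in P. filterlim (\<lambda>t. A t x) at_top at_top"
  shows "AE x in P. last_zero X x = \<infinity>"
  using assms A_carried AE_space
proof eventually_elim
  case (elim x)
  show ?case
  proof (rule ccontr)
    assume "last_zero X x \<noteq> \<infinity>"
    then have "x \<in> (\<Union>n. inactive (real n))" unfolding UN_inactive using elim(3) by simp
    then obtain n where n: "x \<in> inactive (real n)" by blast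
    have const: "A t x = A (real n) x" if "real n \<le> t" for t
    proof (rule Stieltjes_carried_imp_constant[OF A_mono[OF elim(3)] A_cont[OF elim(3)] _ that])
      show "AE u in interval_measure (\<lambda>u. A (max 0 u) x). u \<notin> {real n<..t}"
        using elim(2)
      proof eventually_elim
        case (elim u)
        then show ?case using X_pos_inactive[OF n, of u] by (cases "u \<in> {real n<..t}") simp_all
      qed
    qed simp
    moreover have "eventually (\<lambda>t. A (real n) x + 1 \<le> A t x) at_top"
      using elim(1) unfolding filterlim_at_top by blast
    then obtain T where "\<And>t. T \<le> t \<Longrightarrow> A (real n) x + 1 \<le> A t x"
      by (auto simp: eventually_at_top_linorder)
    then have "A (real n) x + 1 \<le> A (max T (real n)) x" using max.cobounded1 by blast
    moreover have "A (max T (real n)) x = A (real n) x" by (rule const) simp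
    ultimately show False by simp
  qed
qed

text \<open>\<open>AE_Q_A_constant\<close> places \<open>inactive s\<close> inside
  \<open>I \<inter> inactive t\<close> up to a \<open>Q\<close>-null set, and
  \<open>expectation_until_increase_le\<close> says that the larger event has no more mass than the
  smaller. As that mass is finite, the difference is null, and the \<open>Q\<close>-mass is computed
  by \<open>emeasure_Q_inactive\<close> for the event \<open>E \<inter> I\<close> of
  \<open>F t\<close>.\<close>

lemma Q_inactive_eq:
  assumes st: "0 \<le> s" "s \<le> t" and E: "E \<in> sets (F t)"
  shows "emeasure Q (E \<inter> inactive s)
    = ennreal (\<integral>x. X t x * indicator {x \<in> space P. A t x = A s x} x * indicator E x \<partial>P)"
proof -
  define I where "I = {x \<in> space P. A t x = A s x}"
  have t: "0 \<le> t" using st by simp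
  have IF: "I \<in> sets (F t)" unfolding I_def using st by (rule A_eq_set)
  have top: "space P \<in> sets (F u)" if "0 \<le> u" for u using space_F[OF that] sets.top by metis
  have m[measurable]: "I \<in> sets Q" "inactive s \<in> sets Q" "inactive t \<in> sets Q" "E \<in> sets Q"
    using sets_F[OF t] IF E inactive_sets[OF st(1)] inactive_sets[OF t] sets_Q by auto
  have Qs: "emeasure Q (inactive s) = ennreal (\<integral>x. X s x \<partial>P)"
  proof -
    have "emeasure Q (space P \<inter> inactive s) = ennreal (\<integral>x. X s x * indicator (space P) x \<partial>P)"
      by (rule emeasure_Q_inactive[OF st(1) top[OF st(1)]])
    moreover have "space P \<inter> inactive s = inactive s" by (auto simp: inactive_def)
    moreover have "(\<integral>x. X s x * indicator (space P) x \<partial>P) = (\<integral>x. X s x \<partial>P)"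
      by (intro Bochner_Integration.integral_cong) auto
    ultimately show ?thesis by simp
  qed
  have sub: "AE x in Q. x \<in> inactive s \<longrightarrow> x \<in> I \<inter> inactive t"
    using AE_Q_A_constant[OF st]
  proof eventually_elim
    case (elim x)
    then show ?case using inactive_mono[OF st(2)] by (auto simp: I_def inactive_def)
  qed
  have "emeasure Q ((I \<inter> inactive t) - inactive s) = 0"
  proof -
    have "emeasure Q (I \<inter> inactive t) \<le> emeasure Q (inactive s)"
      unfolding Qs emeasure_Q_inactive[OF t IF]
      using expectation_until_increase_le[OF st] by (intro ennreal_leI) (simp add: I_def)
    moreover have "emeasure Q (I \<inter> inactive t)
        = emeasure Q ((I \<inter> inactive t) - inactive s) + emeasure Q ((I \<inter> inactive t) \<inter> inactive s)"
      by (subst plus_emeasure) (auto intro!: arg_cong[where f = "emeasure Q"])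
    moreover have "emeasure Q ((I \<inter> inactive t) \<inter> inactive s) = emeasure Q (inactive s)"
    proof (rule emeasure_eq_AE)
      show "AE x in Q. x \<in> I \<inter> inactive t \<inter> inactive s \<longleftrightarrow> x \<in> inactive s"
        using sub by eventually_elim blast
    qed simp_all
    ultimately have "emeasure Q (inactive s) + emeasure Q ((I \<inter> inactive t) - inactive s)
        \<le> emeasure Q (inactive s) + 0" by (simp add: add.commute)
    then show ?thesis using Qs by (subst (asm) ennreal_add_left_cancel_le) auto
  qed
  then have "(I \<inter> inactive t) - inactive s \<in> null_sets Q" by auto
  then have "AE x in Q. x \<notin> (I \<inter> inactive t) - inactive s" by (rule AE_not_in)
  then have "AE x in Q. x \<in> E \<inter> inactive s \<longleftrightarrow> x \<in> (E \<inter> I) \<inter> inactive t"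
    using sub by eventually_elim blast
  then have "emeasure Q (E \<inter> inactive s) = emeasure Q ((E \<inter> I) \<inter> inactive t)"
    by (rule emeasure_eq_AE) simp_all
  also have "\<dots> = ennreal (\<integral>x. X t x * indicator (E \<inter> I) x \<partial>P)"
    using E IF by (intro emeasure_Q_inactive t) auto
  also have "\<dots> = ennreal (\<integral>x. X t x * indicator I x * indicator E x \<partial>P)"
    by (simp add: indicator_inter_arith mult_ac)
  finally show ?thesis by (simp add: I_def)
qed

end

section \<open>The parts of a measure that are absolutely continuous with respect to
  \<open>P\<close> and to \<open>Q\<close>\<close>

context filtered_probability
begin

lemma measure_eqI_filtration:
  assumes gen: "sets P = sigma_sets (space P) (\<Union>t\<in>{0..}. sets (F t))"
    and R: "finite_measure R" "sets R = sets P" "sets R' = sets P"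
    and eq: "\<And>t. 0 \<le> t \<Longrightarrow> restr_to_subalg R (F t) = restr_to_subalg R' (F t)"
  shows "R = R'"
proof (rule measure_eqI_generator_eq[where E = "\<Union>t\<in>{0..}. sets (F t)" and \<Omega> = "space P" and A = "\<lambda>_. space P"])
  show "Int_stable (\<Union>t\<in>{0..}. sets (F t))"
  proof (rule Int_stableI)
    fix a b assume "a \<in> (\<Union>t\<in>{0..}. sets (F t))" "b \<in> (\<Union>t\<in>{0..}. sets (F t))"
    then obtain s t where st: "0 \<le> s" "0 \<le> t" "a \<in> sets (F s)" "b \<in> sets (F t)" by auto
    then have "a \<inter> b \<in> sets (F (max s t))"
      using sets_F_mono[of s "max s t"] sets_F_mono[of t "max s t"] by auto
    then show "a \<inter> b \<in> (\<Union>t\<in>{0..}. sets (F t))" using st by (intro UN_I[of "max s t"]) auto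
  qed
  show "(\<Union>t\<in>{0..}. sets (F t)) \<subseteq> Pow (space P)"
    using space_F by (fastforce dest: sets.sets_into_space)
  show "emeasure R B = emeasure R' B" if B: "B \<in> (\<Union>t\<in>{0..}. sets (F t))" for B
  proof -
    obtain t where t: "0 \<le> t" "B \<in> sets (F t)" using B by auto
    have "subalgebra R (F t)" "subalgebra R' (F t)"
      using subalg[OF t(1)] R sets_eq_imp_space_eq[OF R(2)] sets_eq_imp_space_eq[OF R(3)]
      by (auto simp: subalgebra_def)
    then show ?thesis using eq[OF t(1)] t(2) by (metis emeasure_restr_to_subalg)
  qed
  have "space P \<in> sets (F 0)" using space_F[of 0] sets.top[of "F 0"] by simp
  then show "range (\<lambda>_. space P) \<subseteq> (\<Union>t\<in>{0..}. sets (F t))" by auto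
  show "emeasure R (space P) \<noteq> \<infinity>" using finite_measure.emeasure_finite[OF R(1)] by simp
qed (use gen R in auto)

lemma density_restr_eqI:
  assumes t: "0 \<le> t" and R: "sets R = sets P" and Y: "Y \<in> borel_measurable (F t)"
    and eq: "\<And>E. E \<in> sets (F t) \<Longrightarrow> emeasure R E = (\<integral>\<^sup>+x. ennreal (Y x) * indicator E x \<partial>P)"
  shows "restr_to_subalg R (F t) = density (restr_to_subalg P (F t)) (\<lambda>x. ennreal (Y x))"
proof -
  note sP = subalg[OF t]
  have sR: "subalgebra R (F t)"
    using sP R sets_eq_imp_space_eq[OF R] by (auto simp: subalgebra_def)
  show ?thesis
  proof (rule measure_eqI)
    fix E assume "E \<in> sets (restr_to_subalg R (F t))"
    then have E: "E \<in> sets (F t)" using sR by (simp add: sets_restr_to_subalg)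
    have "emeasure (density (restr_to_subalg P (F t)) (\<lambda>x. ennreal (Y x))) E
        = (\<integral>\<^sup>+x. ennreal (Y x) * indicator E x \<partial>restr_to_subalg P (F t))"
      using E Y sP by (intro emeasure_density measurable_in_subalg[OF sP])
        (auto simp: sets_restr_to_subalg)
    also have "\<dots> = (\<integral>\<^sup>+x. ennreal (Y x) * indicator E x \<partial>P)"
      using E Y by (intro nn_integral_subalgebra2 sP borel_measurable_times_ennreal
          borel_measurable_indicator measurable_compose[OF _ measurable_ennreal])
    finally show "emeasure (restr_to_subalg R (F t)) E
        = emeasure (density (restr_to_subalg P (F t)) (\<lambda>x. ennreal (Y x))) E"
      using E eq sR by (simp add: emeasure_restr_to_subalg)
  qed (use sP sR in \<open>simp add: sets_restr_to_subalg\<close>)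
qed

lemma emeasure_with_densities:
  assumes "measure_with_densities P F Y R" "0 \<le> t" "E \<in> sets (F t)"
  shows "emeasure R E = (\<integral>\<^sup>+x. ennreal (Y t x) * indicator E x \<partial>P)"
proof -
  have R: "sets R = sets P" "Y t \<in> borel_measurable (F t)"
    "restr_to_subalg R (F t) = density (restr_to_subalg P (F t)) (\<lambda>x. ennreal (Y t x))"
    using assms by (auto simp: measure_with_densities_def)
  have sR: "subalgebra R (F t)"
    using subalg[OF assms(2)] R(1) sets_eq_imp_space_eq[OF R(1)] by (auto simp: subalgebra_def)
  have Em: "E \<in> sets R" using sets_F[OF assms(2,3)] R(1) by simp
  have "emeasure R E = (\<integral>\<^sup>+x. indicator E x \<partial>R)" using Em by simp
  also have "\<dots> = (\<integral>\<^sup>+x. ennreal (Y t x) * indicator E x \<partial>P)"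
    by (rule nn_integral_density_subalgebra[OF subalg[OF assms(2)] sR R(3)])
      (use R(2) assms(3) in measurable)
  finally show ?thesis .
qed

text \<open>Relative to itself \<open>P\<close> has density 1 on every \<open>F t\<close>, so the
  density ratio is \<open>Z\<close> along the integers.\<close>

lemma P_density_part:
  assumes gen: "sets P = sigma_sets (space P) (\<Union>t\<in>{0..}. sets (F t))"
    and Z: "nonneg_on (space P) Z" and R: "measure_with_densities P F Z R"
    and Zinf: "Zinf \<in> borel_measurable P" "AE x in P. ((\<lambda>t. Z t x) \<longlongrightarrow> Zinf x) at_top"
  shows "\<exists>B\<in>sets P. emeasure P B = 0 \<and>
    (\<forall>C\<in>sets P. emeasure R (C - B) = emeasure (density P (\<lambda>x. ennreal (Zinf x))) C)"
proof (rule ac_part_eq_limit_of_density_ratio[of P R P "\<lambda>n. F (real n)" "\<lambda>n x. 1" "\<lambda>n. Z (real n)" Zinf])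
  show "sets P = sigma_sets (space P) (\<Union>n. sets (F (real n)))"
    using generated_by_sequence[OF gen, of 0] by simp
  show "restr_to_subalg P (F (real n)) = density (restr_to_subalg P (F (real n))) (\<lambda>x. ennreal 1)" for n
    by (simp add: density_1)
  show "AE x in P. (\<lambda>n. Z (real n) x / 1) \<longlonglongrightarrow> Zinf x"
    using Zinf(2)
  proof eventually_elim
    case (elim x)
    show ?case
      using filterlim_compose[OF elim filterlim_real_sequentially] by simp
  qed
  show "finite_measure P" by unfold_locales
  show "finite_measure R" "sets R = sets P" using R by (auto simp: measure_with_densities_def)
  show "Z (real n) \<in> borel_measurable (F (real n))"
    "restr_to_subalg R (F (real n)) = density (restr_to_subalg P (F (real n))) (\<lambda>x. ennreal (Z (real n) x))" for n
    using R by (auto simp: measure_with_densities_def)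
  show "0 \<le> Z (real n) x" if "x \<in> space P" for n x
    using Z that by (auto simp: nonneg_on_def)
  show "sets (F (real m)) \<subseteq> sets (F (real n))" if "m \<le> n" for m n
    using that by (intro sets_F_mono) auto
qed (use subalg Zinf in auto)

end

context Sigma_measure_process
begin

text \<open>\<open>Q\<close> may have infinite mass, so the ratio lemma is applied to each finite
  measure \<open>\<kappa> s\<close>. The resulting identities are glued along the increasing events
  \<open>inactive (real s)\<close>, which exhaust the space up to a \<open>Q\<close>-null
  set.\<close>

lemma Q_density_part:
  assumes gen: "sets P = sigma_sets (space P) (\<Union>t\<in>{0..}. sets (F t))"
    and Z: "nonneg_on (space P) Z" and R: "measure_with_densities P F Z R"
    and zinf: "zinf \<in> borel_measurable Q" "AE x in Q. ((\<lambda>t. Z t x / X t x) \<longlongrightarrow> zinf x) at_top"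
  shows "\<exists>B\<in>sets P. emeasure Q B = 0 \<and>
    (\<forall>C\<in>sets P. emeasure R (C - B) = emeasure (density Q (\<lambda>x. ennreal (zinf x))) C)"
proof -
  define \<kappa> where "\<kappa> s = density Q (indicator (inactive (real s)))" for s :: nat
  have iQ[measurable]: "inactive (real s) \<in> sets Q" for s
    using inactive_sets[of "real s"] sets_Q by simp
  have \<kappa>_eq: "emeasure (\<kappa> s) E = emeasure Q (E \<inter> inactive (real s))" if "E \<in> sets P" for s E
    using that sets_Q sets.Int[of E Q "inactive (real s)"] iQ[of s]
    by (simp add: \<kappa>_def emeasure_density indicator_inter_arith[symmetric] Int_commute
        nn_integral_indicator)
  have part: "\<exists>B\<in>sets P. emeasure (\<kappa> s) B = 0 \<and>
      (\<forall>C\<in>sets P. emeasure R (C - B) = emeasure (density (\<kappa> s) (\<lambda>x. ennreal (zinf x))) C)" for s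
  proof -
    \<comment> \<open>The times start at \<open>s\<close> because \<open>Q_inactive_eq\<close> gives
      the density of \<open>\<kappa> s\<close> on \<open>F t\<close> for
      \<open>t \<ge> s\<close>.\<close>
    define t where "t n = real s + real n" for n
    have t: "0 \<le> t n" "real s \<le> t n" for n by (auto simp: t_def)
    define I where "I n = {x \<in> space P. A (t n) x = A (real s) x}" for n
    have I: "I n \<in> sets (F (t n))" for n unfolding I_def using t by (intro A_eq_set) auto
    show ?thesis
    proof (rule ac_part_eq_limit_of_density_ratio[of "\<kappa> s" R P "\<lambda>n. F (t n)"
          "\<lambda>n x. X (t n) x * indicator (I n) x" "\<lambda>n. Z (t n)" zinf])
      show "finite_measure (\<kappa> s)"
      proof (rule finite_measureI)
        have "space P \<in> sets (F (real s))" using space_F[of "real s"] sets.top[of "F (real s)"] by simp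
        then have "emeasure Q (space P \<inter> inactive (real s)) \<noteq> \<infinity>"
          by (subst emeasure_Q_inactive) auto
        then show "emeasure (\<kappa> s) (space (\<kappa> s)) \<noteq> \<infinity>"
          using \<kappa>_eq[of "space P" s] space_Q by (simp add: \<kappa>_def)
      qed
      show "sets P = sigma_sets (space P) (\<Union>n. sets (F (t n)))"
        unfolding t_def by (rule generated_by_sequence[OF gen]) simp
      show "(\<lambda>x. X (t n) x * indicator (I n) x) \<in> borel_measurable (F (t n))" for n
        using X_meas_F[OF t(1)] I by measurable
      then show "restr_to_subalg (\<kappa> s) (F (t n))
          = density (restr_to_subalg P (F (t n))) (\<lambda>x. ennreal (X (t n) x * indicator (I n) x))" for n
      proof (intro density_restr_eqI t)
        show "sets (\<kappa> s) = sets P" using sets_Q by (simp add: \<kappa>_def)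
        fix E assume E: "E \<in> sets (F (t n))"
        have EP: "E \<in> sets P" using sets_F[OF t(1) E] .
        have i: "integrable P (\<lambda>x. X (t n) x * indicator (I n) x * indicator E x)"
          using EP sets_F[OF t(1) I] X_int[OF t(1)] by (intro integrable_real_mult_indicator) auto
        have "emeasure (\<kappa> s) E = ennreal (\<integral>x. X (t n) x * indicator (I n) x * indicator E x \<partial>P)"
          using \<kappa>_eq[OF EP] Q_inactive_eq[OF _ t(2) E] by (simp add: I_def)
        also have "\<dots> = (\<integral>\<^sup>+x. ennreal (X (t n) x * indicator (I n) x * indicator E x) \<partial>P)"
          using X_nonneg[OF t(1)] by (intro nn_integral_eq_integral[symmetric] i) auto
        finally show "emeasure (\<kappa> s) E
            = (\<integral>\<^sup>+x. ennreal (X (t n) x * indicator (I n) x) * indicator E x \<partial>P)"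
          unfolding ennreal_indicator_mult .
      qed
      show "zinf \<in> borel_measurable P" using zinf(1) sets_Q by (simp cong: measurable_cong_sets)
      show "AE x in \<kappa> s. (\<lambda>n. Z (t n) x / (X (t n) x * indicator (I n) x)) \<longlonglongrightarrow> zinf x"
      proof -
        \<comment> \<open>As only countably many times occur, \<open>Q\<close>-a.e. on
          \<open>inactive (real s)\<close> all the indicators in the denominators equal 1, and the
          ratio becomes \<open>Z / X\<close>.\<close>
        have "AE x in Q. \<forall>n. x \<in> inactive (real s) \<longrightarrow> A (t n) x = A (real s) x"
          unfolding AE_all_countable using t by (intro allI AE_Q_A_constant) auto
        with zinf(2) have "AE x in Q. x \<in> inactive (real s) \<longrightarrow>
            (\<lambda>n. Z (t n) x / (X (t n) x * indicator (I n) x)) \<longlonglongrightarrow> zinf x"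
        proof eventually_elim
          case (elim x)
          have "filterlim t at_top sequentially"
            unfolding t_def by (intro filterlim_tendsto_add_at_top[OF tendsto_const] filterlim_real_sequentially)
          then have l: "(\<lambda>n. Z (t n) x / X (t n) x) \<longlonglongrightarrow> zinf x"
            by (rule filterlim_compose[OF elim(1)])
          show ?case
          proof
            assume "x \<in> inactive (real s)"
            then have "x \<in> I n" for n using elim(2) by (auto simp: I_def inactive_def)
            then show "(\<lambda>n. Z (t n) x / (X (t n) x * indicator (I n) x)) \<longlonglongrightarrow> zinf x"
              using l by simp
          qed
        qed
        then have "AE x in Q. 0 < (indicator (inactive (real s)) x :: ennreal) \<longrightarrow>
            (\<lambda>n. Z (t n) x / (X (t n) x * indicator (I n) x)) \<longlonglongrightarrow> zinf x"
          by eventually_elim (simp split: split_indicator)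
        then show ?thesis unfolding \<kappa>_def by (subst AE_density) simp_all
      qed
      show "0 \<le> X (t n) x * indicator (I n) x" if "x \<in> space P" for n x
        using X_nonneg[OF t(1) that] by simp
      show "sets (F (t m)) \<subseteq> sets (F (t n))" if "m \<le> n" for m n
        using that by (intro sets_F_mono t) (simp add: t_def)
      show "sets (\<kappa> s) = sets P" using sets_Q by (simp add: \<kappa>_def)
      show "finite_measure R" "sets R = sets P" using R by (auto simp: measure_with_densities_def)
      show "Z (t n) \<in> borel_measurable (F (t n))"
        "restr_to_subalg R (F (t n)) = density (restr_to_subalg P (F (t n))) (\<lambda>x. ennreal (Z (t n) x))" for n
        using R t(1) by (auto simp: measure_with_densities_def)
      show "0 \<le> Z (t n) x" if "x \<in> space P" for n x
        using Z that t(1) by (auto simp: nonneg_on_def)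
    qed (rule subalg[OF t(1)])
  qed
  then obtain B where B: "\<And>s. B s \<in> sets P" "\<And>s. emeasure (\<kappa> s) (B s) = 0"
    "\<And>s C. C \<in> sets P \<Longrightarrow> emeasure R (C - B s) = emeasure (density (\<kappa> s) (\<lambda>x. ennreal (zinf x))) C"
    by metis
  \<comment> \<open>That \<open>B s\<close> is null for \<open>\<kappa> s\<close> controls only its
    part inside \<open>inactive (real s)\<close>, so only this part enters. The paths with
    \<open>g = \<infinity>\<close> lie in no \<open>inactive (real s)\<close>; including them makes
    the sets \<open>D s\<close> below exhaust \<open>C - B'\<close>.\<close>
  define B' where "B' = (\<Union>s. B s \<inter> inactive (real s)) \<union> {x \<in> space P. last_zero X x = \<infinity>}"
  have "(\<Union>s. B s \<inter> inactive (real s)) \<in> null_sets Q"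
    using B(1,2) \<kappa>_eq sets_Q inactive_sets by (intro null_sets_UN) (auto simp: null_sets_def)
  then have B'_null: "B' \<in> null_sets Q" unfolding B'_def using last_zero_finite by auto
  then have B'Q: "B' \<in> sets Q" and B'P: "B' \<in> sets P" using sets_Q by auto
  have setsR: "sets R = sets P" using R by (simp add: measure_with_densities_def)
  note zinf(1)[measurable]
  let ?D = "density Q (\<lambda>x. ennreal (zinf x))"
  show ?thesis
  proof (intro bexI[of _ B'] conjI ballI)
    show "B' \<in> sets P" "emeasure Q B' = 0" using B'_null B'P by auto
    fix C assume C: "C \<in> sets P"
    define D where "D s = (C - B') \<inter> inactive (real s)" for s
    have D: "D s \<in> sets P" for s unfolding D_def using C B'P inactive_sets by auto
    have incD: "incseq D"
      unfolding D_def incseq_def by (intro allI impI Int_mono inactive_mono) auto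
    have UND: "(\<Union>s. D s) = C - B'"
    proof -
      have "(\<Union>s. D s) = (C - B') \<inter> (\<Union>s. inactive (real s))" by (auto simp: D_def)
      also have "\<dots> = C - B'"
        unfolding UN_inactive using sets.sets_into_space[OF C] by (auto simp: B'_def)
      finally show ?thesis .
    qed
    have "emeasure R (D s) = emeasure ?D (D s)" for s
    proof -
      have "D s - B s = D s" unfolding D_def B'_def by auto
      then have "emeasure R (D s) = emeasure (density (\<kappa> s) (\<lambda>x. ennreal (zinf x))) (D s)"
        using B(3)[OF D, of s s] by simp
      also have "\<dots> = (\<integral>\<^sup>+x. ennreal (zinf x) * indicator (D s) x \<partial>\<kappa> s)"
        using D sets_Q by (intro emeasure_density) (auto simp: \<kappa>_def)
      also have "\<dots> = (\<integral>\<^sup>+x. indicator (inactive (real s)) x * (ennreal (zinf x) * indicator (D s) x) \<partial>Q)"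
        unfolding \<kappa>_def using D[of s] sets_Q by (intro nn_integral_density) auto
      also have "\<dots> = (\<integral>\<^sup>+x. ennreal (zinf x) * indicator (D s) x \<partial>Q)"
        by (intro nn_integral_cong) (auto simp: indicator_def D_def)
      also have "\<dots> = emeasure ?D (D s)"
        using D sets_Q by (intro emeasure_density[symmetric]) auto
      finally show ?thesis .
    qed
    moreover have "(SUP s. emeasure R (D s)) = emeasure R (C - B')"
      unfolding UND[symmetric] using D setsR incD by (intro SUP_emeasure_incseq) auto
    moreover have "(SUP s. emeasure ?D (D s)) = emeasure ?D (C - B')"
      unfolding UND[symmetric] using D sets_Q incD by (intro SUP_emeasure_incseq) auto
    moreover have "emeasure ?D (C - B') = emeasure ?D C"
    proof -
      have "AE x in Q. x \<notin> B'" using B'_null by (rule AE_not_in)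
      then have "B' \<in> null_sets ?D" using B'Q by (auto simp: null_sets_density_iff)
      then show ?thesis using C sets_Q by (intro emeasure_Diff_null_set) auto
    qed
    ultimately show "emeasure R (C - B') = emeasure ?D C" by simp
  qed
qed

end

section \<open>Lebesgue decomposition relative to two measures separated by a set\<close>

text \<open>\<open>M1\<close> is the part of \<open>R\<close> off \<open>B1\<close> and
  \<open>M2\<close> the part off \<open>B2\<close>; what neither sees is the part on
  \<open>B1 \<inter> B2\<close>. The part off both sets would be counted twice, but it is null: on
  \<open>G\<close> it is bounded by \<open>M2\<close>, which does not charge the
  \<open>Q\<close>-null set \<open>G\<close>, and off \<open>G\<close> by \<open>M1\<close>, which
  does not charge the complement of \<open>G\<close>.\<close>

lemma three_part_decomposition:
  fixes P Q R M1 M2 :: "'a measure"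
  assumes sets: "sets Q = sets P" "sets R = sets P" "sets M1 = sets P" "sets M2 = sets P"
    and G: "G \<in> sets P" "emeasure P (space P - G) = 0" "emeasure Q G = 0"
    and B1: "B1 \<in> sets P" "emeasure P B1 = 0"
      "\<And>C. C \<in> sets P \<Longrightarrow> emeasure R (C - B1) = emeasure M1 C"
    and B2: "B2 \<in> sets P" "emeasure Q B2 = 0"
      "\<And>C. C \<in> sets P \<Longrightarrow> emeasure R (C - B2) = emeasure M2 C"
    and ac: "absolutely_continuous P M1" "absolutely_continuous Q M2"
  shows "ac_singular_decomposition P Q R M1 M2 (density R (indicator (B1 \<inter> B2)))"
proof -
  define M3 where "M3 = density R (indicator (B1 \<inter> B2))"
  have sp: "space Q = space P" "space R = space P"
    using sets by (auto dest: sets_eq_imp_space_eq)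
  have M3: "emeasure M3 C = emeasure R (C \<inter> (B1 \<inter> B2))" if "C \<in> sets P" for C
  proof -
    have "emeasure M3 C = (\<integral>\<^sup>+x. indicator (C \<inter> (B1 \<inter> B2)) x \<partial>R)"
      using that sets B1(1) B2(1) unfolding M3_def
      by (subst emeasure_density) (auto intro!: nn_integral_cong simp del: nn_integral_indicator split: split_indicator)
    also have "\<dots> = emeasure R (C \<inter> (B1 \<inter> B2))"
      using that sets B1(1) B2(1) by (intro nn_integral_indicator) auto
    finally show ?thesis .
  qed
  have M10: "emeasure M1 C = 0" if "C \<in> sets P" "emeasure P C = 0" for C
    using ac(1) that sets by (auto simp: absolutely_continuous_def null_sets_def)
  have M20: "emeasure M2 C = 0" if "C \<in> sets P" "emeasure Q C = 0" for C
    using ac(2) that sets by (auto simp: absolutely_continuous_def null_sets_def)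
  have overlap: "emeasure R (C - B1 - B2) = 0" if C: "C \<in> sets P" for C
  proof -
    have "emeasure Q (C \<inter> G) \<le> emeasure Q G" using C G sets by (intro emeasure_mono) auto
    then have "emeasure M2 (C \<inter> G) = 0" using M20[of "C \<inter> G"] G C by auto
    then have 1: "emeasure R ((C \<inter> G) - B2) = 0" using B2(3)[of "C \<inter> G"] C G by auto
    have "emeasure P (C - G) \<le> emeasure P (space P - G)"
      using C G sets.sets_into_space[OF C] by (intro emeasure_mono) auto
    then have "emeasure M1 (C - G) = 0" using M10[of "C - G"] G C by auto
    then have 2: "emeasure R ((C - G) - B1) = 0" using B1(3)[of "C - G"] C G by auto
    have "((C \<inter> G) - B2) \<union> ((C - G) - B1) \<in> null_sets R"
      using 1 2 C G B1(1) B2(1) sets by (intro null_sets.Un) auto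
    then have "C - B1 - B2 \<in> null_sets R"
      by (rule null_sets_subset) (use C B1(1) B2(1) sets in auto)
    then show ?thesis by auto
  qed
  have sum: "emeasure R C = emeasure M1 C + emeasure M2 C + emeasure M3 C" if C: "C \<in> sets P" for C
  proof -
    have m: "C \<in> sets R" "B1 \<in> sets R" "B2 \<in> sets R" using C B1(1) B2(1) sets by auto
    have "emeasure R C = emeasure R (C - B1) + emeasure R (C \<inter> B1)"
      using m by (subst plus_emeasure) (auto intro!: arg_cong[where f = "emeasure R"])
    also have "emeasure R (C \<inter> B1) = emeasure R (C \<inter> B1 - B2) + emeasure R (C \<inter> (B1 \<inter> B2))"
      using m by (subst plus_emeasure) (auto intro!: arg_cong[where f = "emeasure R"])
    also have "emeasure R (C \<inter> B1 - B2) = emeasure R (C - B2)"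
    proof -
      have "emeasure R (C - B2) = emeasure R (C - B1 - B2) + emeasure R (C \<inter> B1 - B2)"
        using m by (subst plus_emeasure) (auto intro!: arg_cong[where f = "emeasure R"])
      then show ?thesis using overlap[OF C] by simp
    qed
    finally show ?thesis using B1(3)[OF C] B2(3)[OF C] M3[OF C] by (simp add: add.assoc)
  qed
  have spP: "space P - B1 \<inter> B2 \<in> sets P" using B1(1) B2(1) by auto
  have disj: "(space P - B1 \<inter> B2) \<inter> (B1 \<inter> B2) = {}" by auto
  have M3c: "emeasure M3 (space P - B1 \<inter> B2) = 0" using M3[OF spP] unfolding disj by simp
  have B12: "space P - (space P - B1 \<inter> B2) = B1 \<inter> B2"
    using sets.sets_into_space[OF B1(1)] by auto
  have nP: "emeasure P (B1 \<inter> B2) = 0"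
    using emeasure_mono[of "B1 \<inter> B2" B1 P] B1 B2 by auto
  have nQ: "emeasure Q (B1 \<inter> B2) = 0"
    using emeasure_mono[of "B1 \<inter> B2" B2 Q] B1 B2 sets by auto
  have "mutually_singular M3 P" "mutually_singular M3 Q"
    using M3c spP nP nQ B12 sp sets unfolding mutually_singular_def
    by (auto simp: M3_def intro!: bexI[of _ "space P - B1 \<inter> B2"])
  then show ?thesis
    using sum ac sets unfolding ac_singular_decomposition_def sum_of_three_def M3_def[symmetric]
    by (auto simp: M3_def)
qed

text \<open>Three disjoint regions determine the components. On a set \<open>E\<close> that is null
  for \<open>P\<close> and \<open>Q\<close> and carries the singular part, only the third survives.
  Off \<open>E\<close>, only the first survives on \<open>G\<close> and only the second outside
  \<open>G\<close>. Each component is therefore \<open>R\<close> restricted to its region.\<close>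

lemma ac_singular_decomposition_unique:
  fixes P Q R :: "'a measure"
  assumes sets: "sets Q = sets P" "sets R = sets P"
    and G: "G \<in> sets P" "emeasure P (space P - G) = 0" "emeasure Q G = 0"
    and M: "ac_singular_decomposition P Q R M1 M2 M3"
    and M': "ac_singular_decomposition P Q R M1' M2' M3'"
  shows "M1' = M1 \<and> M2' = M2 \<and> M3' = M3"
proof -
  have sp: "space Q = space P" using sets by (auto dest: sets_eq_imp_space_eq)
  have support: "\<exists>E\<in>sets P. emeasure P E = 0 \<and> emeasure Q E = 0 \<and> emeasure K3 (space P - E) = 0"
    if K: "ac_singular_decomposition P Q R K1 K2 K3" for K1 K2 K3
  proof -
    have s3: "sets K3 = sets P" using K sets
      by (auto simp: ac_singular_decomposition_def sum_of_three_def)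
    obtain B B' where B: "B \<in> sets P" "emeasure K3 B = 0" "emeasure P (space P - B) = 0"
        "B' \<in> sets P" "emeasure K3 B' = 0" "emeasure Q (space P - B') = 0"
      using K s3 sp unfolding ac_singular_decomposition_def mutually_singular_def by metis
    have "emeasure K3 (B \<union> B') = 0"
      using emeasure_Un_null_set[of B K3 B'] B s3 by (simp add: null_sets_def)
    moreover have "space P - (space P - (B \<union> B')) = B \<union> B'"
      using B(1,4)[THEN sets.sets_into_space] by auto
    moreover have "emeasure P (space P - (B \<union> B')) = 0"
      using emeasure_mono[of "space P - (B \<union> B')" "space P - B" P] B by auto
    moreover have "emeasure Q (space P - (B \<union> B')) = 0"
      using emeasure_mono[of "space P - (B \<union> B')" "space P - B'" Q] B sets by auto
    ultimately show ?thesis using B by (intro bexI[of _ "space P - (B \<union> B')"]) auto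
  qed
  obtain D where D: "D \<in> sets P" "emeasure P D = 0" "emeasure Q D = 0" "emeasure M3 (space P - D) = 0"
    using support[OF M] by blast
  obtain D' where D': "D' \<in> sets P" "emeasure P D' = 0" "emeasure Q D' = 0" "emeasure M3' (space P - D') = 0"
    using support[OF M'] by blast
  \<comment> \<open>The union carries the singular parts of both decompositions and is still null
    for \<open>P\<close> and \<open>Q\<close>, so the same formulas in terms of \<open>R\<close>
    apply to both.\<close>
  define E where "E = D \<union> D'"
  have E: "E \<in> sets P" "emeasure P E = 0" "emeasure Q E = 0"
    using D D' sets emeasure_Un_null_set[of D P D'] emeasure_Un_null_set[of D Q D']
    by (auto simp: E_def null_sets_def)
  have part_values: "emeasure K1 C = emeasure R (C \<inter> G - E) \<and> emeasure K2 C = emeasure R (C - G - E)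
      \<and> emeasure K3 C = emeasure R (C \<inter> E)"
    if K: "ac_singular_decomposition P Q R K1 K2 K3" and K3: "emeasure K3 (space P - E) = 0"
      and C: "C \<in> sets P" for K1 K2 K3 C
  proof -
    have s: "sets K1 = sets P" "sets K2 = sets P" "sets K3 = sets P"
      and sum: "\<And>C. C \<in> sets P \<Longrightarrow> emeasure R C = emeasure K1 C + emeasure K2 C + emeasure K3 C"
      and ac: "absolutely_continuous P K1" "absolutely_continuous Q K2"
      using K sets by (auto simp: ac_singular_decomposition_def sum_of_three_def)
    have n1: "emeasure K1 S = 0" if "S \<in> sets P" "S \<subseteq> (space P - G) \<union> E" for S
    proof -
      have "(space P - G) \<union> E \<in> null_sets P" using G E by (intro null_sets.Un) auto
      then have "S \<in> null_sets P" by (rule null_sets_subset) (use that in auto)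
      then show ?thesis using ac(1) by (auto simp: absolutely_continuous_def)
    qed
    have n2: "emeasure K2 S = 0" if "S \<in> sets P" "S \<subseteq> G \<union> E" for S
    proof -
      have "G \<union> E \<in> null_sets Q" using G E sets by (intro null_sets.Un) auto
      then have "S \<in> null_sets Q" by (rule null_sets_subset) (use that sets in auto)
      then show ?thesis using ac(2) by (auto simp: absolutely_continuous_def)
    qed
    have n3: "emeasure K3 S = 0" if "S \<in> sets P" "S \<subseteq> space P - E" for S
      using emeasure_mono[OF that(2), of K3] K3 E(1) s by auto
    have m: "C \<inter> G - E \<in> sets P" "C - G - E \<in> sets P" "C \<inter> E \<in> sets P" "C - G \<in> sets P" "C \<inter> G \<in> sets P"
      using C G(1) E(1) by auto
    note Csp = sets.sets_into_space[OF C]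
    have diff: "emeasure K C = emeasure K S" if "emeasure K (C - S) = 0" "sets K = sets P" "S \<subseteq> C" "S \<in> sets P" for K S
    proof -
      have "C - S \<in> sets P" using C that by auto
      then have "emeasure K S + emeasure K (C - S) = emeasure K (S \<union> (C - S))"
        using that by (intro plus_emeasure) auto
      moreover have "S \<union> (C - S) = C" using that by auto
      ultimately show ?thesis using that by simp
    qed
    have "emeasure K1 C = emeasure K1 (C \<inter> G - E)"
      using C G(1) E(1) Csp by (intro diff n1 s m) auto
    also have "\<dots> = emeasure R (C \<inter> G - E)"
      unfolding sum[OF m(1)] using n2[OF m(1)] n3[OF m(1)] Csp by (simp add: subset_iff)
    finally have 1: "emeasure K1 C = emeasure R (C \<inter> G - E)" .
    have "emeasure K2 C = emeasure K2 (C - G - E)"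
      using C G(1) E(1) Csp by (intro diff n2 s m) auto
    also have "\<dots> = emeasure R (C - G - E)"
      unfolding sum[OF m(2)] using n1[OF m(2)] n3[OF m(2)] Csp by (simp add: subset_iff)
    finally have 2: "emeasure K2 C = emeasure R (C - G - E)" .
    have "emeasure K3 C = emeasure K3 (C \<inter> E)"
      using C G(1) E(1) Csp by (intro diff n3 s m) auto
    also have "\<dots> = emeasure R (C \<inter> E)"
      unfolding sum[OF m(3)] using n1[OF m(3)] n2[OF m(3)] by (simp add: subset_iff)
    finally show ?thesis using 1 2 by simp
  qed
  have s: "sets M1 = sets P" "sets M2 = sets P" "sets M3 = sets P"
    "sets M1' = sets P" "sets M2' = sets P" "sets M3' = sets P"
    using M M' sets by (auto simp: ac_singular_decomposition_def sum_of_three_def)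
  have "emeasure M3 (space P - E) = 0"
    using emeasure_mono[of "space P - E" "space P - D" M3] D s by (auto simp: E_def)
  note v = part_values[OF M this]
  have "emeasure M3' (space P - E) = 0"
    using emeasure_mono[of "space P - E" "space P - D'" M3'] D' s by (auto simp: E_def)
  note v' = part_values[OF M' this]
  have "M1' = M1" by (rule measure_eqI) (simp_all add: s v v')
  moreover have "M2' = M2" by (rule measure_eqI) (simp_all add: s v v')
  moreover have "M3' = M3" by (rule measure_eqI) (simp_all add: s v v')
  ultimately show ?thesis by simp
qed

section \<open>Decomposition of \<open>QZ\<close> and densities of its singular part\<close>

theorem mainTheorem6:
  fixes P Q QZ :: "'a measure" and F :: "real \<Rightarrow> 'a measure"
    and X N A Z :: "real \<Rightarrow> 'a \<Rightarrow> real" and Zinf zinf :: "'a \<Rightarrow> real"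
  assumes NP: "property_NP P F"
    and X: "class_Sigma P F X N A"
    and Q: "Sigma_measure P F X Q"
    and A_inf: "AE x in P. filterlim (\<lambda>t. A t x) at_top at_top"
    and Z: "martingale P F Z" "cadlag_on (space P) Z" "nonneg_on (space P) Z"
    and QZ: "measure_with_densities P F Z QZ"
    and Zinf: "Zinf \<in> borel_measurable P" "AE x in P. ((\<lambda>t. Z t x) \<longlongrightarrow> Zinf x) at_top"
    and zinf: "zinf \<in> borel_measurable Q" "AE x in Q. ((\<lambda>t. Z t x / X t x) \<longlongrightarrow> zinf x) at_top"
  shows "integrable P Zinf \<and> integrable Q zinf \<and>
    (\<forall>M C. Q_martingale P F Q zinf M \<and> cadlag_cond_exp P F Zinf C \<longrightarrow>
      (\<exists>Qxi.
         measure_with_densities P F (\<lambda>t x. Z t x - M t x - C t x) Qxi \<and>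
         (\<forall>R. measure_with_densities P F (\<lambda>t x. Z t x - M t x - C t x) R \<longrightarrow> R = Qxi) \<and>
         sum_of_three QZ (density Q (\<lambda>x. ennreal (zinf x))) (density P (\<lambda>x. ennreal (Zinf x))) Qxi \<and>
         mutually_singular Qxi P \<and> mutually_singular Qxi Q \<and>
         ac_singular_decomposition P Q QZ
           (density P (\<lambda>x. ennreal (Zinf x))) (density Q (\<lambda>x. ennreal (zinf x))) Qxi \<and>
         (\<forall>M1 M2 M3. ac_singular_decomposition P Q QZ M1 M2 M3 \<longrightarrow>
            M1 = density P (\<lambda>x. ennreal (Zinf x)) \<and>
            M2 = density Q (\<lambda>x. ennreal (zinf x)) \<and>
            M3 = Qxi)))"
proof -
  have fps: "prob_space P" "filtered_space P F"
    using property_NP_filtered_prob_space[OF NP] by (auto simp: filtered_prob_space_def)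
  interpret prob_space P by fact
  interpret Sigma_measure_process P F X N A Q
    by unfold_locales (use fps X Q in auto)
  note gen = property_NP_sets_eq[OF NP]
  have QZ_fin: "finite_measure QZ" and setsQZ: "sets QZ = sets P"
    using QZ by (auto simp: measure_with_densities_def)
  note [measurable] = Zinf(1) zinf(1)
  let ?MP = "density P (\<lambda>x. ennreal (Zinf x))" and ?MQ = "density Q (\<lambda>x. ennreal (zinf x))"
  obtain BP where BP: "BP \<in> sets P" "emeasure P BP = 0"
      "\<And>C. C \<in> sets P \<Longrightarrow> emeasure QZ (C - BP) = emeasure ?MP C"
    using P_density_part[OF gen Z(3) QZ Zinf] by blast
  obtain BQ where BQ: "BQ \<in> sets P" "emeasure Q BQ = 0"
      "\<And>C. C \<in> sets P \<Longrightarrow> emeasure QZ (C - BQ) = emeasure ?MQ C"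
    using Q_density_part[OF gen Z(3) QZ zinf] by blast
  define G where "G = {x \<in> space P. last_zero X x = \<infinity>}"
  have G: "G \<in> sets P" "emeasure Q G = 0" "emeasure P (space P - G) = 0"
  proof -
    show 1: "G \<in> sets P" "emeasure Q G = 0" using last_zero_finite sets_Q by (auto simp: G_def)
    show "emeasure P (space P - G) = 0"
      using AE_P_last_zero_infinite[OF A_inf] 1(1)
      by (subst (asm) AE_iff_measurable[of "space P - G"]) (auto simp: G_def)
  qed
  \<comment> \<open>Since \<open>ennreal\<close> truncates at 0, a finite mass of \<open>?MP\<close>
    bounds only the positive part of \<open>Zinf\<close>. Nonnegativity is what turns this into
    integrability; the same holds for \<open>zinf\<close> and \<open>?MQ\<close>.\<close>
  have Zinf_nn: "AE x in P. 0 \<le> Zinf x"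
    using Zinf(2) AE_space
  proof eventually_elim
    case (elim x)
    show ?case
      by (rule tendsto_lowerbound[OF elim(1)])
        (use Z(3) elim(2) in \<open>auto simp: nonneg_on_def eventually_at_top_linorder\<close>)
  qed
  have zinf_nn: "AE x in Q. 0 \<le> zinf x"
    using zinf(2) AE_space
  proof eventually_elim
    case (elim x)
    have "0 \<le> Z t x / X t x" if "0 \<le> t" for t
      using Z(3) elim(2) X_nonneg[OF that, of x] that by (auto simp: nonneg_on_def space_Q)
    then show ?case
      by (intro tendsto_lowerbound[OF elim(1)]) (auto simp: eventually_at_top_linorder)
  qed
  \<comment> \<open>Both values are \<open>QZ\<close>-masses of sets, hence finite.\<close>
  have dens_fin: "emeasure ?MP C < \<infinity>" "emeasure ?MQ C < \<infinity>" if "C \<in> sets P" for C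
    using BP(3)[OF that] BQ(3)[OF that] finite_measure.emeasure_finite[OF QZ_fin]
    by (metis infinity_ennreal_def less_top)+
  have intP: "integrable P Zinf"
    using dens_fin(1)[of "space P"] Zinf_nn
    by (intro integrableI_nonneg) (auto simp: emeasure_density cong: nn_integral_cong)
  have intQ: "integrable Q zinf"
    using dens_fin(2)[of "space P"] zinf_nn sets.top[of Q]
    by (intro integrableI_nonneg) (auto simp: emeasure_density space_Q[symmetric] sets_Q cong: nn_integral_cong)
  \<comment> \<open>This choice involves no version of \<open>M\<close> or \<open>C\<close>, so one
    measure serves all of them.\<close>
  define Qxi where "Qxi = density QZ (indicator (BP \<inter> BQ))"
  have decomp: "ac_singular_decomposition P Q QZ ?MP ?MQ Qxi"
    unfolding Qxi_def
    by (rule three_part_decomposition[OF sets_Q setsQZ _ _ G(1,3,2) BP BQ])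
      (simp_all add: sets_Q absolutely_continuousI_density)
  have sum: "emeasure QZ B = emeasure ?MP B + emeasure ?MQ B + emeasure Qxi B" if "B \<in> sets P" for B
    using decomp that setsQZ by (auto simp: ac_singular_decomposition_def sum_of_three_def)
  have Qxi: "finite_measure Qxi" "sets Qxi = sets P"
  proof -
    show s: "sets Qxi = sets P" using setsQZ by (simp add: Qxi_def)
    have "emeasure Qxi (space P) \<le> emeasure QZ (space P)" unfolding sum[OF sets.top] by (rule add_increasing) simp_all
    then show "finite_measure Qxi"
      using finite_measure.emeasure_finite[OF QZ_fin, of "space P"] sets_eq_imp_space_eq[OF s]
      by (intro finite_measureI) (metis infinity_ennreal_def top_unique)
  qed
  have xi: "measure_with_densities P F (\<lambda>t x. Z t x - M t x - C t x) Qxi"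
    if M: "Q_martingale P F Q zinf M" and C: "cadlag_cond_exp P F Zinf C" for M C
    unfolding measure_with_densities_def
  proof (intro conjI allI impI Qxi)
    fix t :: real assume t: "0 \<le> t"
    have mF: "Z t \<in> borel_measurable (F t)" "M t \<in> borel_measurable (F t)" "C t \<in> borel_measurable (F t)"
      using Z(1) M C t by (auto simp: martingale_def adapted_def Q_martingale_def cadlag_cond_exp_def)
    show xiF: "(\<lambda>x. Z t x - M t x - C t x) \<in> borel_measurable (F t)" using mF by measurable
    have iZ: "integrable P (Z t)" and iM: "integrable P (M t)"
      using Z(1) M t by (auto simp: martingale_def Q_martingale_def)
    have C_eq: "AE x in P. C t x = real_cond_exp P (F t) Zinf x"
      using C t by (auto simp: cadlag_cond_exp_def)
    then have C_eq': "AE x in P. real_cond_exp P (F t) Zinf x = C t x" by eventually_elim simp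
    interpret fms: finite_measure_subalgebra P "F t"
      by unfold_locales (rule subalg[OF t])
    have iC: "integrable P (C t)"
      by (rule integrable_cong_AE_imp[OF fms.real_cond_exp_int(1)[OF intP] measurable_F[OF t mF(3)] C_eq'])
    have ixi: "integrable P (\<lambda>x. Z t x - M t x - C t x)" using iZ iM iC by simp
    \<comment> \<open>On an event of \<open>F t\<close>, \<open>QZ\<close> has density
      \<open>Z t\<close>, \<open>?MP\<close> has density \<open>C t\<close> by conditioning, and
      \<open>?MQ\<close> has density \<open>M t\<close> by its defining relation tested on
      \<open>indicator E\<close>. All masses are finite, so the additive identity can be solved for
      \<open>Qxi\<close> in the reals.\<close>
    have val: "emeasure Qxi E = ennreal (\<integral>x\<in>E. Z t x - M t x - C t x \<partial>P) \<and>
        0 \<le> (\<integral>x\<in>E. Z t x - M t x - C t x \<partial>P)" if E: "E \<in> sets (F t)" for E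
    proof -
      have EP[measurable]: "E \<in> sets P" using sets_F[OF t E] .
      have EQ[measurable]: "E \<in> sets Q" using EP sets_Q by simp
      have i: "set_integrable P E f" if "integrable P f" for f :: "'a \<Rightarrow> real"
        using that unfolding set_integrable_def by (intro integrable_mult_indicator) auto
      have nn: "emeasure (density K (\<lambda>x. ennreal (f x))) E = ennreal (\<integral>x\<in>E. f x \<partial>K) \<and> 0 \<le> (\<integral>x\<in>E. f x \<partial>K)"
        if "integrable K f" "AE x in K. 0 \<le> f x" "E \<in> sets K" for K :: "'a measure" and f :: "'a \<Rightarrow> real"
      proof -
        have pos: "AE x in K. 0 \<le> indicator E x * f x" using that(2) by eventually_elim simp
        have "emeasure (density K (\<lambda>x. ennreal (f x))) E = (\<integral>\<^sup>+x. ennreal (indicator E x * f x) \<partial>K)"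
          using that by (subst emeasure_density) (auto intro!: nn_integral_cong split: split_indicator)
        also have "\<dots> = ennreal (\<integral>x. indicator E x * f x \<partial>K)"
          using pos integrable_mult_indicator[OF that(3,1)] by (intro nn_integral_eq_integral) simp_all
        finally show ?thesis
          using integral_nonneg_AE[OF pos] by (simp add: set_lebesgue_integral_def)
      qed
      have "AE x in P. 0 \<le> Z t x" using Z(3) t by (auto simp: nonneg_on_def)
      then have Z1: "emeasure QZ E = ennreal (\<integral>x\<in>E. Z t x \<partial>P)" "0 \<le> (\<integral>x\<in>E. Z t x \<partial>P)"
        using nn[OF iZ _ EP] emeasure_with_densities[OF QZ t E] iZ by (auto simp: emeasure_density)
      have C1: "emeasure ?MP E = ennreal (\<integral>x\<in>E. C t x \<partial>P)" "0 \<le> (\<integral>x\<in>E. C t x \<partial>P)"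
        using nn[OF intP Zinf_nn EP] set_integral_cond_exp[OF t E intP C_eq' mF(3)] by simp_all
      have "bounded_measurable (F t) (indicator E)"
        using E by (auto simp: bounded_measurable_def indicator_def intro!: exI[of _ 1])
      then have "(\<integral>x. zinf x * indicator E x \<partial>Q) = (\<integral>x. indicator E x * M t x \<partial>P)"
        using M t unfolding Q_martingale_def by blast
      then have "(\<integral>x\<in>E. zinf x \<partial>Q) = (\<integral>x\<in>E. M t x \<partial>P)"
        by (simp add: set_lebesgue_integral_def mult.commute)
      then have M1: "emeasure ?MQ E = ennreal (\<integral>x\<in>E. M t x \<partial>P)" "0 \<le> (\<integral>x\<in>E. M t x \<partial>P)"
        using nn[OF intQ zinf_nn EQ] by auto
      have fin: "emeasure Qxi E = ennreal (measure Qxi E)"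
        using finite_measure.emeasure_eq_measure[OF Qxi(1)] .
      have "ennreal (\<integral>x\<in>E. Z t x \<partial>P)
          = ennreal ((\<integral>x\<in>E. C t x \<partial>P) + (\<integral>x\<in>E. M t x \<partial>P) + measure Qxi E)"
        using sum[OF EP] Z1 C1 M1 fin by simp
      then have "(\<integral>x\<in>E. Z t x \<partial>P) = (\<integral>x\<in>E. C t x \<partial>P) + (\<integral>x\<in>E. M t x \<partial>P) + measure Qxi E"
        using Z1 C1 M1 by (subst (asm) ennreal_inj) auto
      moreover have "(\<integral>x\<in>E. Z t x - M t x - C t x \<partial>P)
          = (\<integral>x\<in>E. Z t x \<partial>P) - (\<integral>x\<in>E. M t x \<partial>P) - (\<integral>x\<in>E. C t x \<partial>P)"
        using i iZ iM iC by (simp add: set_integral_diff)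
      ultimately show ?thesis using fin by simp
    qed
    \<comment> \<open>The integrals of \<open>\<xi>\<close> over events of \<open>F t\<close> are
      masses of \<open>Qxi\<close>, hence nonnegative. Under the restricted measure these events are
      all the measurable sets, which is what the sign criterion asks for.\<close>
    have "AE x in restr_to_subalg P (F t). 0 \<le> Z t x - M t x - C t x"
    proof (rule sigma_finite_measure.density_nonneg[OF fms.sigma_fin_subalg])
      show "integrable (restr_to_subalg P (F t)) (\<lambda>x. Z t x - M t x - C t x)"
        by (rule integrable_in_subalg[OF subalg[OF t] xiF ixi])
      fix E assume "E \<in> sets (restr_to_subalg P (F t))"
      then have E: "E \<in> sets (F t)" using subalg[OF t] by (simp add: sets_restr_to_subalg)
      have "(\<integral>x\<in>E. Z t x - M t x - C t x \<partial>restr_to_subalg P (F t)) = (\<integral>x\<in>E. Z t x - M t x - C t x \<partial>P)"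
        unfolding set_lebesgue_integral_def
        by (intro integral_subalgebra2 subalg t borel_measurable_scaleR borel_measurable_indicator E xiF)
      then show "0 \<le> (\<integral>x\<in>E. Z t x - M t x - C t x \<partial>restr_to_subalg P (F t))" using val[OF E] by simp
    qed
    then show nn: "AE x in P. 0 \<le> Z t x - M t x - C t x"
      by (rule AE_restr_to_subalg[OF subalg[OF t]])
    show "restr_to_subalg Qxi (F t)
        = density (restr_to_subalg P (F t)) (\<lambda>x. ennreal (Z t x - M t x - C t x))"
    proof (rule density_restr_eqI[OF t Qxi(2) xiF])
      fix E assume E: "E \<in> sets (F t)"
      have EP: "E \<in> sets P" using sets_F[OF t E] .
      have "emeasure Qxi E = ennreal (\<integral>x. (Z t x - M t x - C t x) * indicator E x \<partial>P)"
        using val[OF E] by (simp add: set_lebesgue_integral_def mult.commute)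
      also have "\<dots> = (\<integral>\<^sup>+x. ennreal ((Z t x - M t x - C t x) * indicator E x) \<partial>P)"
      proof (intro nn_integral_eq_integral[symmetric] integrable_real_mult_indicator EP ixi)
        show "AE x in P. 0 \<le> (Z t x - M t x - C t x) * indicator E x"
          using nn by eventually_elim simp
      qed
      finally show "emeasure Qxi E = (\<integral>\<^sup>+x. ennreal (Z t x - M t x - C t x) * indicator E x \<partial>P)"
        unfolding ennreal_indicator_mult .
    qed
  qed
  have sum': "sum_of_three QZ ?MQ ?MP Qxi"
    unfolding sum_of_three_def
  proof (intro conjI ballI)
    fix B assume "B \<in> sets QZ"
    then show "emeasure QZ B = emeasure ?MQ B + emeasure ?MP B + emeasure Qxi B"
      unfolding setsQZ by (subst sum) (simp_all only: add.commute)
  qed (simp_all add: setsQZ sets_Q Qxi(2))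
  have sing: "mutually_singular Qxi P" "mutually_singular Qxi Q"
    using decomp by (auto simp: ac_singular_decomposition_def)
  have unique_xi: "R = Qxi" if "measure_with_densities P F Y Qxi" "measure_with_densities P F Y R" for Y R
    by (rule measure_eqI_filtration[OF gen])
      (use that in \<open>simp_all add: measure_with_densities_def\<close>)
  show ?thesis
  proof (rule conjI[OF intP], rule conjI[OF intQ], intro allI impI exI[of _ Qxi] conjI sum' sing decomp)
    fix M C assume "Q_martingale P F Q zinf M \<and> cadlag_cond_exp P F Zinf C"
    then show d: "measure_with_densities P F (\<lambda>t x. Z t x - M t x - C t x) Qxi"
      by (elim conjE) (rule xi)
    show "R = Qxi" if "measure_with_densities P F (\<lambda>t x. Z t x - M t x - C t x) R" for R
      by (rule unique_xi[OF d that])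
  next
    fix M1 M2 M3 assume "ac_singular_decomposition P Q QZ M1 M2 M3"
    note u = ac_singular_decomposition_unique[OF sets_Q setsQZ G(1,3,2) decomp this]
    show "M1 = ?MP" "M2 = ?MQ" "M3 = Qxi" using u by blast+
  qed
qed

end
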